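(* Let $\mathbf P$ and $\mathbf Q$ be shift-invariant Borel probability measures on $\mathcal A^{\mathbf N}$, where $\mathcal A$ is a finite set. Suppose that $\mathbf P$ is selectively lower decoupled (SLD) and upper decoupled (UD), that $\mathbf Q$ is upper decoupled (UD), that the pair $(\mathbf P,\mathbf Q)$ is nondegenerate (ND), i.e. $\overline q(-1)<0$, and that $\operatorname{supp}\mathbf Q\subseteq\operatorname{supp}\mathbf P$. If, in addition, $\mathbf P$ has the weak Gibbs (WG) property and $\mathbf Q$ is ergodic, then $$\lim_{N\to\infty}Q_N(y,x)=h_{\mathrm c}(\mathbf Q|\mathbf P)$$ for $(\mathbf P\otimes\mathbf Q)$-almost every $(x,y)$, where $Q_N$ is the modified Ziv--Merhav estimator and $h_{\mathrm c}(\mathbf Q|\mathbf P)$ the specific cross entropy.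
   Context: Notation. $\mathcal A$ is a finite set, $\mathbf N=\{1,2,\dots\}$, $\mathcal A^{\mathbf N}$ carries the product ($=$ Borel) $\sigma$-algebra, and $T$ is the left shift. For $x=(x_k)_{k\ge1}$ write $x_i^j=x_ix_{i+1}\cdots x_j$. For $a\in\mathcal A^n$, $[a]=\{x: x_1^n=a\}$ and $\mathbf P[a]=\mathbf P([a])$; for the empty word $\mathbf P[\emptyset]=1$. $\operatorname{supp}\mathbf P_n=\{a\in\mathcal A^n:\mathbf P[a]>0\}$ (for $n=0$, the empty word only) and $\operatorname{supp}\mathbf P=\{x:\mathbf P[x_1^n]>0\text{ for all }n\}$; similarly for $\mathbf Q$. UD: $\mathbf P$ is upper decoupled if there are a nonnegative sequence $(k_n)_{n\ge1}$ with $k_n=o(n)$ and an integer $\tau\ge0$ such that for all $n,m\in\mathbf N$, $a\in\operatorname{supp}\mathbf P_n$, $\xi\in\operatorname{supp}\mathbf P_\tau$, $b\in\operatorname{supp}\mathbf P_m$: $\mathbf P[a\xi b]\le e^{k_n}\mathbf P[a]\mathbf P[b]$. SLD: $\mathbf P$ is selectively lower decoupled if there are a nonnegative sequence $(k_n)_{n\ge1}$ with $k_n=o(n)$ and an integer $\tau\ge0$ such that for all $n,m\in\mathbf N$, $a\in\operatorname{supp}\mathbf P_n$, $b\in\operatorname{supp}\mathbf P_m$ there exist $0\le\ell\le\tau$ and $\xi\in\operatorname{supp}\mathbf P_\ell$ with $\mathbf P[a\xi b]\ge e^{-k_n}\mathbf P[a]\mathbf P[b]$. WG: $\mathbf P$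 is weak Gibbs if it is a measure on a subshift $\Omega'\subseteq\mathcal A^{\mathbf N}$ (closed, $T\Omega'\subseteq\Omega'$, $\mathbf P(\Omega')=1$) and there are a continuous function $\phi:\Omega'\to\mathbf R$ and a nondecreasing sequence $(K_n)_{n\ge1}$ of positive numbers with $K_n=e^{o(n)}$ such that for every $y\in\Omega'$ and $n\in\mathbf N$, $$K_n^{-1}e^{\sum_{j=0}^{n-1}\phi(T^jy)-n\,p_{\mathrm{top}}(\phi)}\le\mathbf P[y_1^n]\le K_n\,e^{\sum_{j=0}^{n-1}\phi(T^jy)-n\,p_{\mathrm{top}}(\phi)},$$ where $p_{\mathrm{top}}(\phi)=\lim_{n\to\infty}\frac1n\ln\sum_{a\in\mathcal A^n,\,[a]\cap\Omega'\neq\emptyset}\sup_{y\in[a]\cap\Omega'}e^{\sum_{j=0}^{n-1}\phi(T^jy)}$ is the topological pressure of $\phi$. Cross-entropic pressure: $q_n(\alpha)=\ln\sum_{a\in\operatorname{supp}\mathbf P_n}\mathbf P[a]^{-\alpha}\,\mathbf Q[a]$ and $\overline q(\alpha)=\limsup_{n\to\infty}\frac1n q_n(\alpha)$. Cross entropy: $h_{\mathrm c}(\mathbf Q|\mathbf P)=\lim_{n\to\infty}-\frac1n\sum_{a\in\mathcal A^n}\mathbf Q[a]\ln\mathbf P[a]$ (the limit exists in this setting; terms with $\mathbf Q[a]=0$ are $0$). Modified Ziv--Merhav (mZM) parsing of $y_1^N$ with respect to $x_1^N$: the first word is the shortest prefix of $y_1^N$ that does not appear as a contiguous substring of $x_1^N$,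 or all of $y_1^N$ if no such prefix exists (in which case the procedure terminates). Given that the first $i$ words have lengths summing to $L_i<N$, the next word is the shortest prefix of $y_{L_i+1}^N$ that does not appear as a contiguous substring of $x_1^N$, or all of $y_{L_i+1}^N$ if no such prefix exists (in which case the procedure terminates). The procedure stops once all of $y_1^N$ is parsed. $c_N=c_N(y|x)$ is the number of words, and $Q_N(y,x)=\frac{c_N(y|x)\ln N}{N-c_N(y|x)}$ (understood as $+\infty$ if $c_N=N$). *)

theory Defs
  imports "HOL-Probability.Probability" "HOL-Library.Sublist" "HOL-Library.Landau_Symbols"
begin

text \<open>
  The alphabet is a type \<open>'a :: finite\<close>. A one-sided sequence \<open>x :: nat \<Rightarrow> 'a\<close> is indexed
  from 0, so \<open>x k\<close> is the letter $x_{k+1}$. Words are lists.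
\<close>

definition seq_space :: "(nat \<Rightarrow> 'a::finite) measure" where
  "seq_space = (\<Pi>\<^sub>M i\<in>UNIV. count_space UNIV)"

definition seq_topology :: "(nat \<Rightarrow> 'a::finite) topology" where
  "seq_topology = product_topology (\<lambda>_. discrete_topology UNIV) UNIV"

definition shift :: "(nat \<Rightarrow> 'a) \<Rightarrow> nat \<Rightarrow> 'a" where
  "shift x = (\<lambda>k. x (Suc k))"

definition initial_word :: "(nat \<Rightarrow> 'a) \<Rightarrow> nat \<Rightarrow> 'a list" where
  "initial_word x n = map x [0..<n]"

definition cylinder :: "'a list \<Rightarrow> (nat \<Rightarrow> 'a) set" where
  "cylinder a = {x. initial_word x (length a) = a}"

definition word_prob :: "(nat \<Rightarrow> 'a) measure \<Rightarrow> 'a list \<Rightarrow> real" where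
  "word_prob P a = measure P (cylinder a)"

definition supp_words :: "(nat \<Rightarrow> 'a) measure \<Rightarrow> nat \<Rightarrow> 'a list set" where
  "supp_words P n = {a. length a = n \<and> word_prob P a > 0}"

definition supp_seqs :: "(nat \<Rightarrow> 'a) measure \<Rightarrow> (nat \<Rightarrow> 'a) set" where
  "supp_seqs P = {x. \<forall>n. word_prob P (initial_word x n) > 0}"

definition shift_invariant_prob :: "(nat \<Rightarrow> 'a::finite) measure \<Rightarrow> bool" where
  "shift_invariant_prob P \<longleftrightarrow>
     prob_space P \<and> sets P = sets seq_space \<and>
     (\<forall>B\<in>sets P. measure P (shift -` B) = measure P B)"

text \<open>To be read for shift-invariant probability measures.\<close>

definition ergodic :: "(nat \<Rightarrow> 'a::finite) measure \<Rightarrow> bool" where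
  "ergodic P \<longleftrightarrow> (\<forall>B\<in>sets P. shift -` B = B \<longrightarrow> measure P B = 0 \<or> measure P B = 1)"

definition upper_decoupled :: "(nat \<Rightarrow> 'a::finite) measure \<Rightarrow> bool" where
  "upper_decoupled P \<longleftrightarrow>
     (\<exists>(k :: nat \<Rightarrow> real) (\<tau> :: nat).
        (\<forall>n\<ge>1. k n \<ge> 0) \<and> k \<in> o(\<lambda>n. real n) \<and>
        (\<forall>n\<ge>1. \<forall>m\<ge>1. \<forall>a\<in>supp_words P n. \<forall>\<xi>\<in>supp_words P \<tau>. \<forall>b\<in>supp_words P m.
           word_prob P (a @ \<xi> @ b) \<le> exp (k n) * word_prob P a * word_prob P b))"

definition selectively_lower_decoupled :: "(nat \<Rightarrow> 'a::finite) measure \<Rightarrow> bool" where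
  "selectively_lower_decoupled P \<longleftrightarrow>
     (\<exists>(k :: nat \<Rightarrow> real) (\<tau> :: nat).
        (\<forall>n\<ge>1. k n \<ge> 0) \<and> k \<in> o(\<lambda>n. real n) \<and>
        (\<forall>n\<ge>1. \<forall>m\<ge>1. \<forall>a\<in>supp_words P n. \<forall>b\<in>supp_words P m.
           \<exists>l\<le>\<tau>. \<exists>\<xi>\<in>supp_words P l.
             word_prob P (a @ \<xi> @ b) \<ge> exp (- k n) * word_prob P a * word_prob P b))"

definition is_subshift :: "(nat \<Rightarrow> 'a::finite) set \<Rightarrow> bool" where
  "is_subshift \<Omega> \<longleftrightarrow> closedin seq_topology \<Omega> \<and> shift ` \<Omega> \<subseteq> \<Omega>"

definition birkhoff_sum :: "((nat \<Rightarrow> 'a) \<Rightarrow> real) \<Rightarrow> nat \<Rightarrow> (nat \<Rightarrow> 'a) \<Rightarrow> real" where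
  "birkhoff_sum \<phi> n y = (\<Sum>j<n. \<phi> ((shift ^^ j) y))"

text \<open>
  For a nonempty subshift and a continuous potential the suprema are over bounded sets of reals
  and the limit exists by submultiplicativity of the sums.
\<close>

definition top_pressure :: "(nat \<Rightarrow> 'a::finite) set \<Rightarrow> ((nat \<Rightarrow> 'a) \<Rightarrow> real) \<Rightarrow> real" where
  "top_pressure \<Omega> \<phi> =
     lim (\<lambda>n. 1 / real n *
       ln (\<Sum>a | length a = n \<and> cylinder a \<inter> \<Omega> \<noteq> {}.
             SUP y\<in>cylinder a \<inter> \<Omega>. exp (birkhoff_sum \<phi> n y)))"

definition weak_Gibbs :: "(nat \<Rightarrow> 'a::finite) measure \<Rightarrow> bool" where
  "weak_Gibbs P \<longleftrightarrow>
     (\<exists>(\<Omega> :: (nat \<Rightarrow> 'a) set) (\<phi> :: (nat \<Rightarrow> 'a) \<Rightarrow> real) (K :: nat \<Rightarrow> real).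
        is_subshift \<Omega> \<and> measure P \<Omega> = 1 \<and>
        continuous_map (subtopology seq_topology \<Omega>) euclideanreal \<phi> \<and>
        (\<forall>n\<ge>1. K n > 0) \<and> (\<forall>m\<ge>1. \<forall>n\<ge>m. K m \<le> K n) \<and>
        (\<lambda>n. ln (K n)) \<in> o(\<lambda>n. real n) \<and>
        (\<forall>y\<in>\<Omega>. \<forall>n\<ge>1.
           inverse (K n) * exp (birkhoff_sum \<phi> n y - real n * top_pressure \<Omega> \<phi>)
             \<le> word_prob P (initial_word y n) \<and>
           word_prob P (initial_word y n)
             \<le> K n * exp (birkhoff_sum \<phi> n y - real n * top_pressure \<Omega> \<phi>)))"

text \<open>Logarithm of a nonnegative real with the convention \<open>log 0 = -\<infinity>\<close> (\<open>ln 0 = 0\<close> in HOL).\<close>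

definition eln :: "real \<Rightarrow> ereal" where
  "eln s = (if s = 0 then -\<infinity> else ereal (ln s))"

definition cross_pressure_n ::
  "(nat \<Rightarrow> 'a::finite) measure \<Rightarrow> (nat \<Rightarrow> 'a) measure \<Rightarrow> nat \<Rightarrow> real \<Rightarrow> ereal" where
  "cross_pressure_n P Q n \<alpha> =
     eln (\<Sum>a\<in>supp_words P n. word_prob P a powr (- \<alpha>) * word_prob Q a)"

definition upper_cross_pressure ::
  "(nat \<Rightarrow> 'a::finite) measure \<Rightarrow> (nat \<Rightarrow> 'a) measure \<Rightarrow> real \<Rightarrow> ereal" where
  "upper_cross_pressure P Q \<alpha> =
     limsup (\<lambda>n. cross_pressure_n P Q n \<alpha> / ereal (real n))"

definition nondegenerate_pair ::
  "(nat \<Rightarrow> 'a::finite) measure \<Rightarrow> (nat \<Rightarrow> 'a) measure \<Rightarrow> bool" where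
  "nondegenerate_pair P Q \<longleftrightarrow> upper_cross_pressure P Q (-1) < 0"

text \<open>
  The cross entropy of \<open>Q\<close> relative to \<open>P\<close>. Terms with \<open>Q[a] = 0\<close> vanish because
  \<open>0 * (-\<infinity>) = 0\<close> in \<^typ>\<open>ereal\<close>.
\<close>

definition cross_entropy ::
  "(nat \<Rightarrow> 'a::finite) measure \<Rightarrow> (nat \<Rightarrow> 'a) measure \<Rightarrow> ereal" where
  "cross_entropy Q P =
     lim (\<lambda>n. - (\<Sum>a | length a = n. ereal (word_prob Q a) * eln (word_prob P a)) / ereal (real n))"

definition mzm_next_length :: "'a list \<Rightarrow> 'a list \<Rightarrow> nat" where
  "mzm_next_length xs ys =
     (if \<exists>k\<le>length ys. \<not> sublist (take k ys) xs
      then LEAST k. \<not> sublist (take k ys) xs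
      else length ys)"

lemma mzm_next_length_pos:
  assumes "ys \<noteq> []"
  shows "mzm_next_length xs ys > 0"
proof (cases "\<exists>k\<le>length ys. \<not> sublist (take k ys) xs")
  case True
  then obtain k where k: "\<not> sublist (take k ys) xs" by blast
  then have "\<not> sublist (take (LEAST k. \<not> sublist (take k ys) xs) ys) xs"
    by (rule LeastI)
  then have "(LEAST k. \<not> sublist (take k ys) xs) \<noteq> 0"
    by (metis sublist_Nil_left take_0)
  with True show ?thesis by (simp add: mzm_next_length_def)
next
  case False
  with assms show ?thesis unfolding mzm_next_length_def by (simp only: if_False length_greater_0_conv not_False_eq_True)
qed

text \<open>
  If every prefix of \<open>ys\<close> occurs in \<open>xs\<close>, the next word is all of \<open>ys\<close>, so the recursion then
  ends with that word.
\<close>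

function mzm_parse :: "'a list \<Rightarrow> 'a list \<Rightarrow> 'a list list" where
  "mzm_parse xs ys =
     (if ys = [] then []
      else take (mzm_next_length xs ys) ys # mzm_parse xs (drop (mzm_next_length xs ys) ys))"
  by pat_completeness auto
termination
  by (relation "inv_image less_than (\<lambda>(xs, ys). length ys)") (auto simp: mzm_next_length_pos)

declare mzm_parse.simps [simp del]

definition mzm_count :: "nat \<Rightarrow> (nat \<Rightarrow> 'a) \<Rightarrow> (nat \<Rightarrow> 'a) \<Rightarrow> nat" where
  "mzm_count N y x = length (mzm_parse (initial_word x N) (initial_word y N))"

definition mzm_estimator :: "nat \<Rightarrow> (nat \<Rightarrow> 'a) \<Rightarrow> (nat \<Rightarrow> 'a) \<Rightarrow> ereal" where
  "mzm_estimator N y x =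
     (if mzm_count N y x = N then \<infinity>
      else ereal (real (mzm_count N y x) * ln (real N) / (real N - real (mzm_count N y x))))"

end

theory Submission
  imports Defs "HOL-Real_Asymp.Real_Asymp"
begin

text \<open>
  By the weak Gibbs property, $-\ln \mathbf P[y_j^{j+n}]$ is, up to $o(n)$, a Birkhoff sum of a bounded
  function \<open>g\<close> (the normalised potential), and Birkhoff sums are exactly additive over the words
  of the parsing. It therefore suffices to see that almost every parsed word contributes about
  $\ln N$. A word that does not occur in $x_1^N$ has probability at most $N^{-1+\epsilon}$, because
  selective lower decoupling makes every likelier word of length $O(\ln N)$ occur. Conversely, a word
  of probability below $N^{-1-\epsilon}$ occurs in $x_1^N$ with probability at most
  $N^{-\epsilon}$, so only $O(N^{1-\epsilon/2})$ starting positions in \<open>y\<close> produce such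
  matches, and by nondegeneracy all matches have length $O(\ln N)$. Hence $c_N \ln N / N$ has the
  same limit as the Birkhoff averages of \<open>g\<close> along \<open>y\<close>, namely the integral of
  \<open>g\<close> with respect to \<open>Q\<close>, which is the cross entropy.
\<close>

section \<open>Words and stationary measures\<close>

text \<open>The ends of the parsed words depend on both sequences, so no limit theorem applies to a
  parsed word directly; every estimate is made uniform over all starts and lengths that can arise.
  The two sides then differ in strength. Missing a likely word has stretched-exponentially small
  probability, so all likely words can be handled at once. An unlikely match cannot be excluded
  everywhere: N starts in \<open>y\<close>, N positions in \<open>x\<close> and probability
  N^(-1-\<epsilon>) leave a union bound of order N^(1-\<epsilon>), which is not small. Such starts
  are therefore counted and not excluded, and each is charged the trivial bound, the word length
  times the supremum of |g|. The logarithmic bound on match lengths serves twice: it makes this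
  charge small, and it turns the Gibbs error exp(o(n)) of one word into o(ln N) on the logarithmic
  scale, hence into o(N) over O(N / ln N) words.\<close>

lemma space_seq_space [simp]: "space seq_space = UNIV"
  by (simp add: seq_space_def space_PiM)

lemma measurable_letter: "(\<lambda>x. x i) \<in> measurable seq_space (count_space UNIV)"
  unfolding seq_space_def by (rule measurable_component_singleton) simp

lemma measurable_seq_shift: "shift \<in> measurable seq_space seq_space"
  unfolding shift_def
  by (subst (2) seq_space_def) (auto intro!: measurable_PiM_single' measurable_letter simp: space_PiM)

lemma initial_word_Suc: "initial_word x (Suc n) = initial_word x n @ [x n]"
  by (simp add: initial_word_def)

lemma length_initial_word [simp]: "length (initial_word x n) = n"
  by (simp add: initial_word_def)

lemma measurable_initial_word:
  "(\<lambda>x::nat \<Rightarrow> 'a::finite. initial_word x n) \<in> measurable seq_space (count_space UNIV)"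
proof (induction n)
  case 0
  then show ?case by (simp add: initial_word_def)
next
  case (Suc n)
  have "(\<lambda>p::'a list \<times> 'a. fst p @ [snd p]) \<in> measurable (count_space UNIV \<Otimes>\<^sub>M count_space UNIV) (count_space UNIV)"
    by (subst pair_measure_countable) (auto intro: countableI_type)
  from measurable_compose[OF measurable_Pair[OF Suc measurable_letter[of n]] this]
  show ?case by (simp add: initial_word_Suc)
qed

section \<open>Finite windows of a sequence\<close>

lemma shift_funpow: "(shift ^^ j) x = (\<lambda>i. x (j + i))"
  by (induction j arbitrary: x) (auto simp: shift_def)

text \<open>Start and length are free and the letters come from the infinite sequence, so no range
  condition is ever needed. \<open>initial_word_shift\<close> turns a window into a prefix of a
  shifted point, where invariance applies.\<close>

definition subword :: "(nat \<Rightarrow> 'a) \<Rightarrow> nat \<Rightarrow> nat \<Rightarrow> 'a list" where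
  "subword x j n = map x [j..<j + n]"

lemma length_subword [simp]: "length (subword x j n) = n"
  by (simp add: subword_def)

lemma subword_0 [simp]: "subword x j 0 = []"
  by (simp add: subword_def)

lemma initial_word_shift: "initial_word ((shift ^^ j) x) n = subword x j n"
  by (rule nth_equalityI) (auto simp: initial_word_def shift_funpow subword_def)

lemma subword_initial: "subword x 0 n = initial_word x n"
  by (simp add: subword_def initial_word_def)

lemma take_subword: "m \<le> n \<Longrightarrow> take m (subword x j n) = subword x j m"
  by (simp add: subword_def take_map)

lemma sublist_subword_mono:
  "m \<le> n \<Longrightarrow> sublist (subword x j n) w \<Longrightarrow> sublist (subword x j m) w"
  by (metis sublist_order.order_trans sublist_take take_subword)

lemma initial_word_eq_take: "M \<le> N \<Longrightarrow> initial_word x M = take M (initial_word x N)"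
  by (simp add: initial_word_def take_map)

lemma sublist_initial_word_mono:
  "M \<le> N \<Longrightarrow> sublist w (initial_word x M) \<Longrightarrow> sublist w (initial_word x N)"
  by (metis initial_word_eq_take sublist_order.order_trans sublist_take)

lemma sublist_initial_word_iff:
  "sublist w (initial_word x N) \<longleftrightarrow> (\<exists>i. i + length w \<le> N \<and> subword x i (length w) = w)"
proof
  assume "sublist w (initial_word x N)"
  then obtain u v where uv: "initial_word x N = u @ w @ v" by (auto simp: sublist_def)
  have len: "length u + length w \<le> N"
    using arg_cong[OF uv, of length] by simp
  have "subword x (length u) (length w) = take (length w) (drop (length u) (initial_word x N))"
    using len by (simp add: initial_word_def subword_def drop_map take_map)
  also have "\<dots> = w" by (simp add: uv)
  finally show "\<exists>i. i + length w \<le> N \<and> subword x i (length w) = w" using len by blast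
next
  assume "\<exists>i. i + length w \<le> N \<and> subword x i (length w) = w"
  then obtain i where i: "i + length w \<le> N" "subword x i (length w) = w" by blast
  have "w = take (length w) (drop i (initial_word x N))"
    using i by (simp add: initial_word_def subword_def drop_map take_map)
  then show "sublist w (initial_word x N)"
    by (metis sublist_order.order_trans sublist_take sublist_drop)
qed

lemma cylinder_sets: "cylinder a \<in> sets seq_space"
proof -
  have "cylinder a = (\<lambda>x. initial_word x (length a)) -` {a} \<inter> space seq_space"
    by (auto simp: cylinder_def)
  also have "\<dots> \<in> sets seq_space"
    using measurable_initial_word by (rule measurable_sets) simp
  finally show ?thesis .
qed

lemma finite_words: "finite {a :: 'a::finite list. length a = n \<and> R a}"
  by (rule finite_subset[OF _ finite_lists_length_eq[of UNIV n]]) auto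

text \<open>A basic open set restricts finitely many coordinates, so an open set is a union of
  cylinders, and there are only countably many words. This is what makes the continuous potential of
  the weak Gibbs property measurable.\<close>

lemma openin_seq_topology_sets:
  assumes "openin seq_topology U"
  shows "U \<in> sets seq_space"
proof -
  have nbhd: "\<exists>n. cylinder (initial_word x n) \<subseteq> U" if "x \<in> U" for x
  proof -
    from assms that obtain V where V: "finite {i. V i \<noteq> UNIV}" "x \<in> Pi\<^sub>E UNIV V" "Pi\<^sub>E UNIV V \<subseteq> U"
      unfolding seq_topology_def openin_product_topology_alt by auto
    from V(1) obtain n where n: "\<And>i. V i \<noteq> UNIV \<Longrightarrow> i < n"
      by (auto simp: finite_nat_set_iff_bounded)
    have "cylinder (initial_word x n) \<subseteq> Pi\<^sub>E UNIV V"
    proof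
      fix z assume "z \<in> cylinder (initial_word x n)"
      then have z: "z i = x i" if "i < n" for i
        using that by (auto simp: cylinder_def initial_word_def)
      have "z i \<in> V i" for i
        using n[of i] z[of i] V(2) by (cases "V i = UNIV") (auto simp: PiE_iff)
      then show "z \<in> Pi\<^sub>E UNIV V" by auto
    qed
    with V(3) show ?thesis by blast
  qed
  have "U = (\<Union>a\<in>{a. cylinder a \<subseteq> U}. cylinder a)"
  proof
    show "U \<subseteq> (\<Union>a\<in>{a. cylinder a \<subseteq> U}. cylinder a)"
    proof
      fix x assume "x \<in> U"
      then obtain n where "cylinder (initial_word x n) \<subseteq> U" using nbhd by blast
      moreover have "x \<in> cylinder (initial_word x n)" by (simp add: cylinder_def)
      ultimately show "x \<in> (\<Union>a\<in>{a. cylinder a \<subseteq> U}. cylinder a)" by blast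
    qed
  qed auto
  also have "\<dots> \<in> sets seq_space"
    by (intro sets.countable_UN'' cylinder_sets) auto
  finally show ?thesis .
qed

lemma seq_topology_topspace [simp]: "topspace seq_topology = UNIV"
  by (simp add: seq_topology_def)

lemma closedin_seq_topology_cylinderI:
  assumes "closedin seq_topology C" "\<And>n. cylinder (initial_word x n) \<inter> C \<noteq> {}"
  shows "x \<in> C"
proof (rule ccontr)
  assume "x \<notin> C"
  have "openin seq_topology (- C)"
    using assms(1) by (simp add: closedin_def Compl_eq_Diff_UNIV)
  with \<open>x \<notin> C\<close> obtain V where V: "finite {i. V i \<noteq> UNIV}" "x \<in> Pi\<^sub>E UNIV V" "Pi\<^sub>E UNIV V \<subseteq> - C"
    unfolding seq_topology_def openin_product_topology_alt by (simp, metis ComplI)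
  from V(1) obtain n where n: "\<And>i. V i \<noteq> UNIV \<Longrightarrow> i < n"
    by (auto simp: finite_nat_set_iff_bounded)
  from assms(2) obtain z where z: "z \<in> C" "z \<in> cylinder (initial_word x n)" by blast
  then have z': "z i = x i" if "i < n" for i
    using that by (auto simp: cylinder_def initial_word_def)
  have "z i \<in> V i" for i
    using n[of i] z'[of i] V(2) by (cases "V i = UNIV") (auto simp: PiE_iff)
  then show False using V(3) z(1) by auto
qed

section \<open>Shift-invariant probability measures\<close>

locale stationary =
  fixes P :: "(nat \<Rightarrow> 'a::finite) measure"
  assumes shift_invariant: "shift_invariant_prob P"
begin

lemma prob_space_P: "prob_space P"
  using shift_invariant by (simp add: shift_invariant_prob_def)

lemma sets_P [measurable_cong]: "sets P = sets seq_space"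
  using shift_invariant by (simp add: shift_invariant_prob_def)

end

sublocale stationary \<subseteq> prob_space P
  by (rule prob_space_P)

context stationary
begin

lemma space_P [simp]: "space P = UNIV"
  using sets_eq_imp_space_eq[OF sets_P] by simp

lemma measurable_shift_P [measurable]: "shift \<in> measurable P P"
  using measurable_seq_shift measurable_cong_sets[OF sets_P sets_P] by blast

lemma measurable_shift_funpow [measurable]: "(shift ^^ j) \<in> measurable P P"
  by (induction j) (auto simp: comp_def intro: measurable_compose)

lemma measurable_initial_word_P [measurable]:
  "(\<lambda>x. initial_word x n) \<in> measurable P (count_space UNIV)"
  using measurable_initial_word measurable_cong_sets[OF sets_P refl] by blast

lemma measurable_subword [measurable]:
  "(\<lambda>x. subword x j n) \<in> measurable P (count_space UNIV)"
  unfolding initial_word_shift[symmetric] by measurable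

lemma distr_shift: "distr P P shift = P"
proof (rule measure_eqI)
  fix A assume A: "A \<in> sets (distr P P shift)"
  then have "measure P (shift -` A) = measure P A"
    using shift_invariant by (simp add: shift_invariant_prob_def)
  with A show "emeasure (distr P P shift) A = emeasure P A"
    by (simp add: emeasure_distr emeasure_eq_measure)
qed simp

lemma distr_shift_funpow: "distr P P (shift ^^ j) = P"
proof (induction j)
  case 0
  then show ?case by (simp add: id_def)
next
  case (Suc j)
  have "distr P P (shift ^^ Suc j) = distr (distr P P (shift ^^ j)) P shift"
    by (subst distr_distr) auto
  with Suc show ?case by (simp only: distr_shift)
qed

lemma prob_shift_funpow: "B \<in> sets P \<Longrightarrow> prob ((shift ^^ j) -` B) = prob B"
  using measure_distr[of "shift ^^ j" P P B] by (simp add: distr_shift_funpow)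

lemma integral_shift_funpow:
  fixes f :: "(nat \<Rightarrow> 'a) \<Rightarrow> real"
  assumes "f \<in> borel_measurable P"
  shows "(\<integral>x. f ((shift ^^ j) x) \<partial>P) = (\<integral>x. f x \<partial>P)"
  using integral_distr[of "shift ^^ j" P P f] assms by (simp add: distr_shift_funpow)

lemma cylinder_sets_P [measurable, simp]: "cylinder a \<in> sets P"
  by (simp add: sets_P cylinder_sets)

lemma word_prob_nonneg [simp]: "word_prob P a \<ge> 0"
  by (simp add: word_prob_def)

lemma word_prob_le_1 [simp]: "word_prob P a \<le> 1"
  by (simp add: word_prob_def)

lemma prob_word_at: "prob {x. subword x j (length a) = a} = word_prob P a"
proof -
  have "{x. subword x j (length a) = a} = (shift ^^ j) -` cylinder a"
    by (auto simp: cylinder_def initial_word_shift)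
  then show ?thesis by (simp add: prob_shift_funpow word_prob_def)
qed

text \<open>Invariance removes the start \<open>j\<close>. Applied to \<open>Q\<close>, the choice
  \<open>F = word_prob P\<close> yields the sum controlled by nondegeneracy, and the logarithm of
  \<open>word_prob P\<close> yields the finite-length cross entropy.\<close>

lemma integral_subword:
  fixes F :: "'a list \<Rightarrow> real"
  shows "(\<integral>x. F (subword x j n) \<partial>P) = (\<Sum>a | length a = n. word_prob P a * F a)"
proof -
  have "(\<integral>x. F (subword x j n) \<partial>P) = (\<integral>x. F (initial_word x n) \<partial>P)"
    unfolding initial_word_shift[symmetric] by (rule integral_shift_funpow) measurable
  also have "\<dots> = (\<integral>x. (\<Sum>a | length a = n. indicat_real (cylinder a) x * F a) \<partial>P)"
  proof (intro Bochner_Integration.integral_cong refl)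
    fix x
    have "(\<Sum>a | length a = n. indicat_real (cylinder a) x * F a)
        = (\<Sum>a | length a = n. if a = initial_word x n then F a else 0)"
      by (intro sum.cong) (auto simp: cylinder_def indicator_def)
    also have "\<dots> = F (initial_word x n)"
      using finite_words[of n "\<lambda>_. True"] by (subst sum.delta) simp_all
    finally show "F (initial_word x n) = (\<Sum>a | length a = n. indicat_real (cylinder a) x * F a)" ..
  qed
  also have "\<dots> = (\<Sum>a | length a = n. word_prob P a * F a)"
    by (simp add: Bochner_Integration.integral_sum word_prob_def emeasure_eq_measure)
  finally show ?thesis .
qed

lemma AE_supp_seqs: "AE x in P. x \<in> supp_seqs P"
proof -
  have "AE x in P. word_prob P (initial_word x n) > 0" for n
  proof (rule AE_I)
    let ?N = "\<Union>a\<in>{a. length a = n \<and> word_prob P a = 0}. cylinder a"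
    show "{x \<in> space P. \<not> word_prob P (initial_word x n) > 0} \<subseteq> ?N"
      by (auto simp: cylinder_def not_less order_antisym[OF _ word_prob_nonneg])
    show N: "?N \<in> sets P" by (intro sets.finite_UN finite_words) auto
    have "?N \<in> null_sets P"
      by (intro null_sets_UN' countable_finite finite_words)
        (auto simp: null_sets_def word_prob_def emeasure_eq_measure)
    then show "emeasure P ?N = 0" by auto
  qed
  then show ?thesis by (simp add: supp_seqs_def AE_all_countable)
qed

end

section \<open>Birkhoff averages\<close>

context stationary
begin

text \<open>The maximal ergodic inequality. The empty sum \<open>S 0\<close> belongs to the maximum,
  so \<open>M\<close> is nonnegative; the integral of \<open>M x - M (shift x)\<close> vanishes by
  invariance, and boundedness of \<open>g\<close> settles all integrability.\<close>

lemma maximal_inequality: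
  fixes g :: "(nat \<Rightarrow> 'a) \<Rightarrow> real"
  assumes [measurable]: "g \<in> borel_measurable P" and bd: "\<And>x. \<bar>g x\<bar> \<le> B"
  defines "S \<equiv> \<lambda>k x. birkhoff_sum g k x"
  shows "(\<integral>x. g x * indicator {x. \<exists>k\<le>n. S k x > 0} x \<partial>P) \<ge> 0"
proof -
  have S_meas [measurable]: "S k \<in> borel_measurable P" for k
    unfolding S_def birkhoff_sum_def by measurable
  define M where "M x = (MAX k\<in>{..n}. S k x)" for x
  have M_meas [measurable]: "M \<in> borel_measurable P"
    unfolding M_def by measurable
  have S_bd: "\<bar>S k x\<bar> \<le> real k * B" for k x
  proof -
    have "\<bar>S k x\<bar> \<le> (\<Sum>j<k. \<bar>g ((shift ^^ j) x)\<bar>)"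
      unfolding S_def birkhoff_sum_def by (rule sum_abs)
    also have "\<dots> \<le> (\<Sum>j<k. B)" by (intro sum_mono bd)
    finally show ?thesis by simp
  qed
  have B0: "B \<ge> 0" using bd[of undefined] by linarith
  have S_Suc: "S (Suc k) x = g x + S k (shift x)" for k x
    unfolding S_def birkhoff_sum_def
    by (simp only: sum.lessThan_Suc_shift funpow_Suc_right o_apply funpow_0)
  have M0: "M x \<ge> 0" for x
  proof -
    have "S 0 x \<le> M x" unfolding M_def by (intro Max_ge) auto
    then show ?thesis by (simp add: S_def birkhoff_sum_def)
  qed
  have M_in: "\<exists>k\<le>n. M x = S k x" for x
    using Max_in[of "(\<lambda>k. S k x) ` {..n}"] unfolding M_def image_iff by fastforce
  have M_bd: "\<bar>M x\<bar> \<le> real n * B" for x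
  proof -
    obtain k where "k \<le> n" "M x = S k x" using M_in by blast
    then show ?thesis using S_bd[of k x] mult_right_mono[of "real k" "real n" B] B0 by simp
  qed
  define E where "E = {x. \<exists>k\<le>n. S k x > 0}"
  have E_iff: "x \<in> E \<longleftrightarrow> M x > 0" for x
  proof
    assume "x \<in> E"
    then obtain k where "k \<le> n" "S k x > 0" by (auto simp: E_def)
    moreover have "S k x \<le> M x" unfolding M_def using \<open>k \<le> n\<close> by (intro Max_ge) auto
    ultimately show "M x > 0" by linarith
  next
    assume "M x > 0" then show "x \<in> E" using M_in[of x] by (auto simp: E_def)
  qed
  have "{x \<in> space P. M x > 0} \<in> sets P" by measurable
  then have E_sets [measurable]: "E \<in> sets P" by (simp add: E_iff[symmetric])
  \<comment> \<open>Garsia: where the running maximum \<open>M\<close> is positive, \<open>M \<le> g + M \<circ> shift\<close>.\<close>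
  have le: "M x - M (shift x) \<le> g x * indicator E x" for x
  proof (cases "x \<in> E")
    case False
    then have "M x = 0" using E_iff[of x] M0[of x] by simp
    then show ?thesis using False M0[of "shift x"] by simp
  next
    case True
    obtain k where k: "k \<le> n" "M x = S k x" using M_in by blast
    have "k \<noteq> 0" using True E_iff k by (auto simp: S_def birkhoff_sum_def intro: ccontr)
    then obtain k' where k': "k = Suc k'" by (cases k) auto
    have "S k' (shift x) \<le> M (shift x)" unfolding M_def using k k' by (intro Max_ge) auto
    then show ?thesis using True k k' S_Suc by simp
  qed
  have intM: "integrable P M"
    by (rule integrable_const_bound[where B = "real n * B"]) (use M_bd in auto)
  have intMs: "integrable P (\<lambda>x. M (shift x))"
    by (rule integrable_const_bound[where B = "real n * B"]) (use M_bd in auto)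
  have "0 = (\<integral>x. M x - M (shift x) \<partial>P)"
    using integral_shift_funpow[of M 1] intM intMs by simp
  also have "\<dots> \<le> (\<integral>x. g x * indicator E x \<partial>P)"
  proof (rule integral_mono)
    show "integrable P (\<lambda>x. M x - M (shift x))" using intM intMs by simp
    show "integrable P (\<lambda>x. g x * indicator E x)"
      by (rule integrable_const_bound[where B = B]) (use bd B0 in \<open>auto simp: indicator_def\<close>)
  qed (use le in auto)
  finally show ?thesis by (simp add: E_def)
qed

lemma birkhoff_sum_const_diff: "birkhoff_sum (\<lambda>x. f x - c) n x = birkhoff_sum f n x - real n * c"
  for f :: "(nat \<Rightarrow> 'a) \<Rightarrow> real"
  by (simp add: birkhoff_sum_def sum_subtractf)

text \<open>The set \<open>D\<close> where the limsup exceeds \<open>c\<close> is exactly invariant,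
  since a shift changes a Birkhoff sum by two bounded terms only. If \<open>D\<close> had full
  measure, almost every point would lie in \<open>E n\<close> for large \<open>n\<close>, and the
  maximal inequality for \<open>f - c\<close> would pass to the limit and contradict the choice of
  \<open>c\<close>.\<close>

lemma birkhoff_limsup_le:
  fixes f :: "(nat \<Rightarrow> 'a) \<Rightarrow> real"
  assumes erg: "ergodic P" and f [measurable]: "f \<in> borel_measurable P"
    and bd: "\<And>x. \<bar>f x\<bar> \<le> B" and c: "c > (\<integral>x. f x \<partial>P)"
  shows "AE x in P. limsup (\<lambda>n. ereal (birkhoff_sum f n x / real n)) \<le> ereal c"
proof -
  define L where "L x = limsup (\<lambda>n. ereal (birkhoff_sum f n x / real n))" for x
  have S_meas [measurable]: "(\<lambda>x. birkhoff_sum f k x) \<in> borel_measurable P" for k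
    unfolding birkhoff_sum_def by measurable
  have L_meas [measurable]: "L \<in> borel_measurable P" unfolding L_def by measurable
  define D where "D = {x. L x > ereal c}"
  have "{x \<in> space P. L x > ereal c} \<in> sets P" by measurable
  then have D_sets [measurable]: "D \<in> sets P" by (simp add: D_def)
  have L_inv: "L (shift x) = L x" for x
  proof -
    have "birkhoff_sum f n (shift x) = birkhoff_sum f (Suc n) x - f x" for n
      by (simp only: birkhoff_sum_def sum.lessThan_Suc_shift funpow_Suc_right o_apply funpow_0)
    then have eq: "birkhoff_sum f n (shift x) / real n =
        (birkhoff_sum f n x / real n) + (f ((shift ^^ n) x) - f x) / real n" for n
      by (simp add: birkhoff_sum_def add_divide_distrib diff_divide_distrib)
    have lim: "(\<lambda>n. ereal ((f ((shift ^^ n) x) - f x) / real n)) \<longlonglongrightarrow> ereal 0"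
    proof (rule tendsto_ereal, rule Lim_null_comparison)
      show "\<forall>\<^sub>F n in sequentially. norm ((f ((shift ^^ n) x) - f x) / real n) \<le> 2 * B / real n"
      proof (intro always_eventually allI)
        fix n
        have "\<bar>f ((shift ^^ n) x) - f x\<bar> \<le> 2 * B"
          using bd[of "(shift ^^ n) x"] bd[of x] by linarith
        then show "norm ((f ((shift ^^ n) x) - f x) / real n) \<le> 2 * B / real n"
          by (simp add: divide_right_mono)
      qed
      show "(\<lambda>n. 2 * B / real n) \<longlonglongrightarrow> 0" by (rule lim_const_over_n)
    qed
    have "L (shift x) = limsup (\<lambda>n. ereal ((f ((shift ^^ n) x) - f x) / real n) + ereal (birkhoff_sum f n x / real n))"
      unfolding L_def eq by (simp add: add.commute)
    also have "\<dots> = 0 + L x"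
      using ereal_limsup_lim_add[OF lim, of "\<lambda>n. ereal (birkhoff_sum f n x / real n)"]
      by (simp add: L_def zero_ereal_def)
    finally show ?thesis by simp
  qed
  have "shift -` D = D" using L_inv by (auto simp: D_def)
  with erg D_sets have "prob D = 0 \<or> prob D = 1" by (auto simp: ergodic_def)
  moreover have "prob D \<noteq> 1"
  proof
    assume D1: "prob D = 1"
    define g where "g x = f x - c" for x
    have g_meas [measurable]: "g \<in> borel_measurable P" unfolding g_def by measurable
    have g_bd: "\<bar>g x\<bar> \<le> B + \<bar>c\<bar>" for x using bd[of x] by (simp add: g_def)
    define E where "E n = {x. \<exists>k\<le>n. birkhoff_sum g k x > 0}" for n
    have gS_meas [measurable]: "(\<lambda>x. birkhoff_sum g k x) \<in> borel_measurable P" for k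
      unfolding birkhoff_sum_def by measurable
    have E_sets [measurable]: "E n \<in> sets P" for n
    proof -
      have "E n = {x \<in> space P. \<exists>k\<le>n. birkhoff_sum g k x > 0}" by (simp add: E_def)
      also have "\<dots> \<in> sets P" by measurable
      finally show ?thesis .
    qed
    have nonneg: "(\<integral>x. g x * indicator (E n) x \<partial>P) \<ge> 0" for n
      using maximal_inequality[OF g_meas g_bd, of n] by (simp add: E_def)
    have "(\<lambda>n. \<integral>x. g x * indicator (E n) x \<partial>P) \<longlonglongrightarrow> (\<integral>x. g x \<partial>P)"
    proof (rule integral_dominated_convergence[where w = "\<lambda>_. B + \<bar>c\<bar>"])
      show "AE x in P. (\<lambda>n. g x * indicator (E n) x) \<longlonglongrightarrow> g x"
      proof -
        have "AE x in P. x \<in> D" using prob_eq_1[OF D_sets] D1 by simp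
        then show ?thesis
        proof eventually_elim
          case (elim x)
          then have "ereal c < limsup (\<lambda>n. ereal (birkhoff_sum f n x / real n))"
            by (simp add: D_def L_def)
          then have "\<exists>\<^sub>F n in sequentially. ereal c < ereal (birkhoff_sum f n x / real n)"
            by (rule contrapos_pp) (simp add: not_frequently not_less Limsup_bounded)
          then obtain k where k: "k > 0" "c < birkhoff_sum f k x / real k"
            unfolding frequently_sequentially less_ereal.simps by (metis Suc_le_lessD)
          then have "birkhoff_sum g k x > 0"
            unfolding g_def birkhoff_sum_const_diff by (simp add: field_simps)
          then have "\<forall>\<^sub>F n in sequentially. g x * indicator (E n) x = g x"
            unfolding eventually_sequentially E_def by (auto simp: indicator_def intro!: exI[of _ k])
          then show ?case by (rule tendsto_eventually)
        qed
      qed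
      show "AE x in P. norm (g x * indicator (E n) x) \<le> B + \<bar>c\<bar>" for n
        using g_bd by (intro always_eventually) (auto simp: indicator_def intro: order_trans[OF abs_ge_zero])
    qed auto
    then have "(\<integral>x. g x \<partial>P) \<ge> 0"
      by (rule LIMSEQ_le_const) (use nonneg in auto)
    moreover have "integrable P f"
      by (rule integrable_const_bound[where B = B]) (use bd in auto)
    ultimately show False using c prob_space by (simp add: g_def)
  qed
  ultimately have "prob D = 0" by blast
  then have "AE x in P. x \<notin> D" using prob_eq_0[OF D_sets] by simp
  then show ?thesis by eventually_elim (simp add: D_def L_def not_less)
qed

theorem birkhoff:
  fixes f :: "(nat \<Rightarrow> 'a) \<Rightarrow> real"
  assumes erg: "ergodic P" and f [measurable]: "f \<in> borel_measurable P"
    and bd: "\<And>x. \<bar>f x\<bar> \<le> B"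
  shows "AE x in P. (\<lambda>n. birkhoff_sum f n x / real n) \<longlonglongrightarrow> (\<integral>x. f x \<partial>P)"
proof -
  let ?h = "\<integral>x. f x \<partial>P"
  \<comment> \<open>The levels \<open>?h + 1 / real (Suc m)\<close> form a countable family, so one
    null set serves them all. The lower bound is the upper bound for the negated function.\<close>
  have up: "AE x in P. \<forall>m. limsup (\<lambda>n. ereal (birkhoff_sum f n x / real n)) \<le> ereal (?h + 1 / real (Suc m))"
    unfolding AE_all_countable
    by (intro allI birkhoff_limsup_le[OF erg f bd]) simp
  have f': "(\<lambda>x. - f x) \<in> borel_measurable P" by measurable
  have low: "AE x in P. \<forall>m. limsup (\<lambda>n. ereal (birkhoff_sum (\<lambda>x. - f x) n x / real n))
      \<le> ereal (- ?h + 1 / real (Suc m))"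
    unfolding AE_all_countable
    by (intro allI birkhoff_limsup_le[OF erg f', of B]) (use bd in auto)
  from up low show ?thesis
  proof eventually_elim
    case (elim x)
    show ?case
    proof (rule LIMSEQ_I)
      fix r :: real assume r: "r > 0"
      obtain m where m: "1 / real (Suc m) < r" using nat_approx_posE[OF r] .
      have "limsup (\<lambda>n. ereal (birkhoff_sum f n x / real n)) < ereal (?h + r)"
        using elim(1) m by (meson add_strict_left_mono ereal_less(2) le_less_trans less_ereal.simps(1))
      then have 1: "\<forall>\<^sub>F n in sequentially. ereal (birkhoff_sum f n x / real n) < ereal (?h + r)"
        by (rule Limsup_lessD)
      have "limsup (\<lambda>n. ereal (birkhoff_sum (\<lambda>x. - f x) n x / real n)) < ereal (- ?h + r)"
        using elim(2) m by (meson add_strict_left_mono ereal_less(2) le_less_trans less_ereal.simps(1))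
      then have 2: "\<forall>\<^sub>F n in sequentially. ereal (birkhoff_sum (\<lambda>x. - f x) n x / real n) < ereal (- ?h + r)"
        by (rule Limsup_lessD)
      from 1 2 have "\<forall>\<^sub>F n in sequentially. norm (birkhoff_sum f n x / real n - ?h) < r"
        by eventually_elim (auto simp: birkhoff_sum_def sum_negf abs_less_iff)
      then show "\<exists>no. \<forall>n\<ge>no. norm (birkhoff_sum f n x / real n - ?h) < r"
        by (simp add: eventually_sequentially)
    qed
  qed
qed

end

section \<open>Occurrences of likely words\<close>

lemma (in prob_space) AE_eventually_not_in:
  assumes [measurable]: "\<And>n. A n \<in> events"
    and le: "\<forall>\<^sub>F n in sequentially. prob (A n) \<le> b n" and "summable (b :: nat \<Rightarrow> real)"
  shows "AE x in M. \<forall>\<^sub>F n in sequentially. x \<notin> A n"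
proof -
  have "summable (\<lambda>n. prob (A n))"
    by (rule summable_comparison_test_ev[OF _ assms(3)]) (use le in \<open>simp add: measure_nonneg\<close>)
  then have "AE x in M. \<forall>\<^sub>F n in sequentially. x \<in> space M - A n"
    by (intro borel_cantelli_AE1) (auto simp: emeasure_eq_measure)
  then show ?thesis by eventually_elim (auto elim: eventually_mono)
qed

context stationary
begin

lemma events_initial_word [measurable]: "{x. R (initial_word x N)} \<in> events"
proof -
  have "{x. R (initial_word x N)} = (\<lambda>x. initial_word x N) -` {w. R w} \<inter> space P" by auto
  also have "\<dots> \<in> events" by (rule measurable_sets[OF measurable_initial_word_P]) simp
  finally show ?thesis .
qed

lemma events_subword [measurable]: "{x. R (subword x j n)} \<in> events"
proof -
  have "{x. R (subword x j n)} = (\<lambda>x. subword x j n) -` {w. R w} \<inter> space P" by auto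
  also have "\<dots> \<in> events" by (rule measurable_sets[OF measurable_subword]) simp
  finally show ?thesis .
qed

lemma prob_subword: "prob {x. R (subword x j n)} = (\<Sum>a | length a = n \<and> R a. word_prob P a)"
proof -
  have "{x. R (subword x j n)} = (\<Union>a\<in>{a. length a = n \<and> R a}. {x. subword x j n = a})"
    by auto
  then have "prob {x. R (subword x j n)} = (\<Sum>a | length a = n \<and> R a. prob {x. subword x j n = a})"
    by (simp, intro finite_measure_finite_Union finite_words)
      (auto simp: disjoint_family_on_def)
  also have "\<dots> = (\<Sum>a | length a = n \<and> R a. word_prob P a)"
    by (intro sum.cong refl) (auto simp: prob_word_at)
  finally show ?thesis .
qed

lemma prob_occurs_le: "prob {x. sublist w (initial_word x N)} \<le> (real N + 1) * word_prob P w"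
proof -
  have "{x. sublist w (initial_word x N)} \<subseteq> (\<Union>i\<le>N. {x. subword x i (length w) = w})"
    by (fastforce simp: sublist_initial_word_iff)
  then have "prob {x. sublist w (initial_word x N)} \<le> prob (\<Union>i\<le>N. {x. subword x i (length w) = w})"
    by (intro finite_measure_mono) auto
  also have "\<dots> \<le> (\<Sum>i\<le>N. prob {x. subword x i (length w) = w})"
    by (intro finite_measure_subadditive_finite) auto
  also have "\<dots> = (real N + 1) * word_prob P w"
    by (simp add: prob_word_at)
  finally show ?thesis .
qed

text \<open>Put \<open>a\<close> in front of each block \<open>b\<close> that avoids it. Lower
  decoupling charges an error depending on the length of the left word only, so with
  \<open>a\<close> on the left \<kappa> does not deteriorate as \<open>m\<close> grows. The gap may
  depend on \<open>b\<close>, and the factor \<open>real \<tau> + 1\<close> is the price of fixing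
  one gap for all blocks.\<close>

lemma prob_avoids_step:
  assumes lower: "\<And>b. b \<in> supp_words P m \<Longrightarrow>
      \<exists>l\<le>\<tau>. \<exists>\<xi>\<in>supp_words P l. word_prob P (a @ \<xi> @ b) \<ge> \<kappa> * word_prob P b"
  shows "prob {x. \<not> sublist a (initial_word x (m + (length a + \<tau>)))}
    \<le> (1 - \<kappa> / (real \<tau> + 1)) * prob {x. \<not> sublist a (initial_word x m)}"
proof -
  define n where "n = length a"
  define V where "V m = {x. \<not> sublist a (initial_word x m)}" for m
  define W where "W = {b. length b = m \<and> (\<not> sublist a b \<and> word_prob P b > 0)}"
  define S where "S l = {x. \<not> sublist a (subword x (n + l) m)}" for l
  define T where "T l = cylinder a \<inter> S l" for l
  define C where "C l b = cylinder a \<inter> {x. subword x (n + l) m = b}" for l b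
  have V_sets [measurable]: "V m \<in> events" for m unfolding V_def by simp
  have S_sets [measurable]: "S l \<in> events" for l unfolding S_def by simp
  have T_sets [measurable]: "T l \<in> events" for l unfolding T_def by simp
  have C_sets [measurable]: "C l b \<in> events" for l b unfolding C_def by simp
  have fin: "finite W" unfolding W_def by (rule finite_words)
  have probV: "prob (V m) = (\<Sum>b\<in>W. word_prob P b)"
  proof -
    have "prob (V m) = (\<Sum>b | length b = m \<and> \<not> sublist a b. word_prob P b)"
      unfolding V_def using prob_subword[of "\<lambda>b. \<not> sublist a b" 0 m] by (simp add: subword_initial)
    also have "\<dots> = (\<Sum>b\<in>W. word_prob P b)"
      unfolding W_def
      by (intro sum.mono_neutral_right finite_words) (auto simp: less_le)
    finally show ?thesis .
  qed
  have probS: "prob (S l) = prob (V m)" for l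
    unfolding S_def V_def prob_subword[of "\<lambda>b. \<not> sublist a b"] subword_initial[symmetric] ..
  have "\<exists>l\<le>\<tau>. \<kappa> * word_prob P b \<le> prob (C l b)" if "b \<in> W" for b
  proof -
    have "b \<in> supp_words P m" using that by (auto simp: W_def supp_words_def)
    then obtain l \<xi> where l: "l \<le> \<tau>" "\<xi> \<in> supp_words P l" "word_prob P (a @ \<xi> @ b) \<ge> \<kappa> * word_prob P b"
      using lower by blast
    have len: "length \<xi> = l" "length b = m" using l that by (auto simp: supp_words_def W_def)
    have "cylinder (a @ \<xi> @ b) \<subseteq> C l b"
    proof
      fix x assume "x \<in> cylinder (a @ \<xi> @ b)"
      then have x: "initial_word x (n + l + m) = a @ \<xi> @ b"
        by (simp add: cylinder_def n_def len add.assoc)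
      have "initial_word x n = take n (initial_word x (n + l + m))"
        by (rule initial_word_eq_take) simp
      then have 1: "initial_word x n = a" using x by (simp add: n_def)
      have "subword x (n + l) m = drop (n + l) (initial_word x (n + l + m))"
        by (simp add: subword_def initial_word_def drop_map)
      also have "\<dots> = b" using x by (simp add: n_def len)
      finally show "x \<in> C l b" using 1 by (simp add: C_def cylinder_def n_def)
    qed
    then have "word_prob P (a @ \<xi> @ b) \<le> prob (C l b)"
      unfolding word_prob_def by (intro finite_measure_mono) auto
    with l show ?thesis by force
  qed
  then obtain f where f: "\<And>b. b \<in> W \<Longrightarrow> f b \<le> \<tau> \<and> \<kappa> * word_prob P b \<le> prob (C (f b) b)"
    by metis
  have "\<kappa> * prob (V m) = (\<Sum>b\<in>W. \<kappa> * word_prob P b)"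
    by (simp add: probV sum_distrib_left)
  also have "\<dots> \<le> (\<Sum>b\<in>W. \<Sum>l\<le>\<tau>. prob (C l b))"
  proof (rule sum_mono)
    fix b assume b: "b \<in> W"
    have "prob (C (f b) b) \<le> (\<Sum>l\<le>\<tau>. prob (C l b))"
      using f[OF b] by (intro member_le_sum) auto
    then show "\<kappa> * word_prob P b \<le> (\<Sum>l\<le>\<tau>. prob (C l b))" using f[OF b] by linarith
  qed
  also have "\<dots> = (\<Sum>l\<le>\<tau>. \<Sum>b\<in>W. prob (C l b))" by (rule sum.swap)
  \<comment> \<open>For a fixed gap the events \<open>C l b\<close> are disjoint, because the window
    read at \<open>n + l\<close> determines \<open>b\<close>.\<close>
  also have "\<dots> \<le> (\<Sum>l\<le>\<tau>. prob (T l))"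
  proof (rule sum_mono)
    fix l
    have "(\<Sum>b\<in>W. prob (C l b)) = prob (\<Union>b\<in>W. C l b)"
      by (rule finite_measure_finite_Union[symmetric]) (auto simp: fin disjoint_family_on_def C_def)
    also have "\<dots> \<le> prob (T l)"
      by (rule finite_measure_mono) (auto simp: C_def T_def S_def W_def)
    finally show "(\<Sum>b\<in>W. prob (C l b)) \<le> prob (T l)" .
  qed
  finally have sumT: "\<kappa> * prob (V m) \<le> (\<Sum>l\<le>\<tau>. prob (T l))" .
  \<comment> \<open>Pigeonhole over the \<tau> + 1 possible gaps.\<close>
  have "\<exists>l\<le>\<tau>. \<kappa> / (real \<tau> + 1) * prob (V m) \<le> prob (T l)"
  proof (rule ccontr)
    assume "\<not> ?thesis"
    then have "(\<Sum>l\<le>\<tau>. prob (T l)) < (\<Sum>l\<le>\<tau>. \<kappa> / (real \<tau> + 1) * prob (V m))"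
      by (intro sum_strict_mono) auto
    also have "\<dots> = \<kappa> * prob (V m)" by (simp add: add.commute)
    finally show False using sumT by simp
  qed
  then obtain l where l: "l \<le> \<tau>" "\<kappa> / (real \<tau> + 1) * prob (V m) \<le> prob (T l)" by blast
  \<comment> \<open>The window at \<open>n + l\<close> ends within the first
    \<open>m + (n + \<tau>)\<close> letters because \<open>l\<close> is at most \<tau>. So avoiding
    \<open>a\<close> forces this window to avoid \<open>a\<close> and also forbids \<open>a\<close>
    as a prefix.\<close>
  have "V (m + (n + \<tau>)) \<subseteq> S l - T l"
  proof
    fix x assume "x \<in> V (m + (n + \<tau>))"
    then have no: "\<not> sublist a (initial_word x (m + (n + \<tau>)))" by (simp add: V_def)
    have "subword x 0 n \<noteq> a"
      using no by (auto simp: sublist_initial_word_iff n_def)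
    then have "x \<notin> cylinder a" by (simp add: cylinder_def subword_initial n_def)
    moreover have "sublist (subword x (n + l) m) (initial_word x (m + (n + \<tau>)))"
      unfolding sublist_initial_word_iff using l(1) by (auto intro!: exI[of _ "n + l"])
    then have "\<not> sublist a (subword x (n + l) m)"
      using no sublist_order.order_trans by blast
    ultimately show "x \<in> S l - T l" by (auto simp: S_def T_def)
  qed
  then have "prob (V (m + (n + \<tau>))) \<le> prob (S l - T l)" by (intro finite_measure_mono) auto
  also have "\<dots> = prob (S l) - prob (T l)"
    by (rule finite_measure_Diff) (auto simp: T_def)
  also have "\<dots> \<le> (1 - \<kappa> / (real \<tau> + 1)) * prob (V m)"
    using l(2) by (simp add: probS algebra_simps)
  finally show ?thesis by (simp add: V_def n_def)
qed

lemma prob_avoids_le: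
  assumes lower: "\<And>m b. m \<ge> 1 \<Longrightarrow> b \<in> supp_words P m \<Longrightarrow>
      \<exists>l\<le>\<tau>. \<exists>\<xi>\<in>supp_words P l. word_prob P (a @ \<xi> @ b) \<ge> \<kappa> * word_prob P b"
    and \<kappa>: "0 \<le> \<kappa>" "\<kappa> \<le> 1" and N: "1 + j * (length a + \<tau>) \<le> N"
  shows "prob {x. \<not> sublist a (initial_word x N)} \<le> exp (- real j * \<kappa> / (real \<tau> + 1))"
proof -
  let ?d = "\<kappa> / (real \<tau> + 1)"
  have d: "?d \<le> 1" using \<kappa> by (simp add: divide_le_eq)
  \<comment> \<open>The induction starts from length 1 and not 0, because lower decoupling speaks of
    nonempty right-hand words only.\<close>
  have ind: "prob {x. \<not> sublist a (initial_word x (1 + j * (length a + \<tau>)))} \<le> (1 - ?d) ^ j" for j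
  proof (induction j)
    case 0
    then show ?case by simp
  next
    case (Suc j)
    have "prob {x. \<not> sublist a (initial_word x (1 + j * (length a + \<tau>) + (length a + \<tau>)))}
        \<le> (1 - ?d) * prob {x. \<not> sublist a (initial_word x (1 + j * (length a + \<tau>)))}"
      by (rule prob_avoids_step, rule lower) auto
    also have "\<dots> \<le> (1 - ?d) * (1 - ?d) ^ j"
      using d by (intro mult_left_mono Suc) auto
    finally show ?case by (simp add: algebra_simps)
  qed
  have "prob {x. \<not> sublist a (initial_word x N)}
      \<le> prob {x. \<not> sublist a (initial_word x (1 + j * (length a + \<tau>)))}"
    using N sublist_initial_word_mono by (intro finite_measure_mono) auto
  also have "\<dots> \<le> (1 - ?d) ^ j" by (rule ind)
  also have "\<dots> \<le> exp (- ?d) ^ j"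
    using d exp_ge_add_one_self[of "- ?d"] by (intro power_mono) auto
  also have "\<dots> = exp (- real j * \<kappa> / (real \<tau> + 1))"
    by (simp add: exp_of_nat_mult[symmetric])
  finally show ?thesis .
qed

lemma card_likely_words:
  assumes "t > 0"
  shows "real (card {a. length a = n \<and> word_prob P a \<ge> t}) \<le> 1 / t"
proof -
  have "real (card {a. length a = n \<and> word_prob P a \<ge> t}) * t
      = (\<Sum>a | length a = n \<and> word_prob P a \<ge> t. t)" by simp
  also have "\<dots> \<le> (\<Sum>a | length a = n \<and> word_prob P a \<ge> t. word_prob P a)"
    by (rule sum_mono) auto
  also have "\<dots> = prob {x. word_prob P (subword x 0 n) \<ge> t}"
    by (rule prob_subword[symmetric])
  finally show ?thesis using assms prob_le_1 by (simp add: field_simps order_trans)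
qed

end

text \<open>The additive constant absorbs finitely many small \<open>n\<close>. A bound valid for
  every \<open>n\<close> is needed because it is applied to words of all lengths, short ones
  included.\<close>

lemma smallo_linear_bound:
  fixes k :: "nat \<Rightarrow> real"
  assumes "k \<in> o(\<lambda>n. real n)" "\<eta> > 0"
  obtains c where "c \<ge> 0" "\<And>n. k n \<le> \<eta> * real n + c"
proof -
  from landau_o.smallD[OF assms] obtain n0 where n0: "\<And>n. n \<ge> n0 \<Longrightarrow> \<bar>k n\<bar> \<le> \<eta> * real n"
    by (auto simp: eventually_sequentially)
  define c where "c = (\<Sum>n<n0. \<bar>k n\<bar>)"
  have "k n \<le> \<eta> * real n + c" for n
  proof (cases "n < n0")
    case True
    then have "\<bar>k n\<bar> \<le> c" unfolding c_def by (intro member_le_sum) auto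
    moreover have "0 \<le> \<eta> * real n" using assms(2) by simp
    ultimately show ?thesis by linarith
  next
    case False
    moreover have "c \<ge> 0" unfolding c_def by (rule sum_nonneg) simp
    ultimately show ?thesis using n0[of n] by linarith
  qed
  moreover have "c \<ge> 0" unfolding c_def by (rule sum_nonneg) simp
  ultimately show thesis using that by blast
qed

section \<open>All likely words of logarithmic length occur\<close>

context stationary
begin

text \<open>Union bound and Borel-Cantelli: there are only polynomially many likely words, while
  about N / ln N disjoint attempts with success probability at least of order N^(\<epsilon>/2 - 1)
  make each miss stretched-exponentially unlikely. The length cutoff controls the decoupling error;
  its \<open>+ 1\<close> is there because a parsed word is a match followed by one letter.\<close>

lemma AE_likely_words_occur:
  assumes sld: "selectively_lower_decoupled P" and \<epsilon>: "\<epsilon> > 0" and C: "C > 0"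
  shows "AE x in P. \<forall>\<^sub>F N in sequentially. \<forall>a. length a \<ge> 1 \<and> real (length a) \<le> C * ln (real N) + 1
      \<and> word_prob P a \<ge> real N powr (\<epsilon> - 1) \<longrightarrow> sublist a (initial_word x N)"
proof -
  from sld obtain k :: "nat \<Rightarrow> real" and \<tau> :: nat where k: "\<And>n. n \<ge> 1 \<Longrightarrow> k n \<ge> 0" "k \<in> o(\<lambda>n. real n)"
    and lower: "\<And>n m a b. n \<ge> 1 \<Longrightarrow> m \<ge> 1 \<Longrightarrow> a \<in> supp_words P n \<Longrightarrow> b \<in> supp_words P m \<Longrightarrow>
      \<exists>l\<le>\<tau>. \<exists>\<xi>\<in>supp_words P l. word_prob P (a @ \<xi> @ b) \<ge> exp (- k n) * word_prob P a * word_prob P b"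
    unfolding selectively_lower_decoupled_def by blast
  \<comment> \<open>With this choice the decoupling error of a word of length
    \<open>C * ln (real N) + 1\<close> is a constant times N^(-\<epsilon>/2), which spends half of
    the margin \<epsilon>.\<close>
  define \<eta> where "\<eta> = \<epsilon> / (2 * C)"
  have \<eta>: "\<eta> > 0" using \<epsilon> C by (simp add: \<eta>_def)
  obtain c where c: "c \<ge> 0" "\<And>n. k n \<le> \<eta> * real n + c"
    using smallo_linear_bound[OF k(2) \<eta>] by blast
  define c2 where "c2 = exp (- (\<eta> + c)) / (real \<tau> + 1)"
  have c2: "c2 > 0" by (simp add: c2_def)
  define A where "A N = {a. length a \<ge> 1 \<and> real (length a) \<le> C * ln (real N) + 1
      \<and> word_prob P a \<ge> real N powr (\<epsilon> - 1)}" for N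
  define F where "F N = (\<Union>a\<in>A N. {x. \<not> sublist a (initial_word x N)})" for N
  \<comment> \<open>The first factor bounds from below the number \<open>j\<close> of attempts, the
    \<open>- 1\<close> coming from integer division; the second bounds
    \<open>\<kappa> / (real \<tau> + 1)\<close>. The product grows like N^(\<epsilon>/2) / ln N and
    so beats every power of N.\<close>
  define h where "h N = exp (- (((real N - 1) / (C * ln (real N) + 1 + real \<tau>) - 1)
      * (c2 * real N powr (\<epsilon> / 2 - 1))))" for N
  define D where "D N = nat \<lfloor>C * ln (real N) + 1\<rfloor>" for N
  have D_ge: "n \<le> D N" if "real n \<le> C * ln (real N) + 1" for n N
    using that unfolding D_def by (rule le_nat_floor)
  have A_eq: "A N \<subseteq> (\<Union>n\<in>{1..D N}. {a. length a = n \<and> word_prob P a \<ge> real N powr (\<epsilon> - 1)})" for N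
    by (auto simp: A_def intro: D_ge)
  have finA: "finite (A N)" for N
    by (rule finite_subset[OF A_eq]) (intro finite_UN_I finite_words finite_atLeastAtMost)
  have cardA: "real (card (A N)) \<le> (C * ln (real N) + 1) * real N" if N: "N \<ge> 1" for N
  proof -
    have L: "C * ln (real N) \<ge> 0" using N C by simp
    have "card (A N) \<le> (\<Sum>n\<in>{1..D N}. card {a. length a = n \<and> word_prob P a \<ge> real N powr (\<epsilon> - 1)})"
      by (rule order_trans[OF card_mono[OF _ A_eq] card_UN_le]) (auto intro!: finite_UN_I finite_words)
    then have "real (card (A N)) \<le> (\<Sum>n\<in>{1..D N}. real (card {a. length a = n \<and> word_prob P a \<ge> real N powr (\<epsilon> - 1)}))"
      by (simp only: of_nat_sum[symmetric] of_nat_le_iff)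
    also have "\<dots> \<le> (\<Sum>n\<in>{1..D N}. real N)"
    proof (rule sum_mono)
      fix n
      have "real (card {a. length a = n \<and> word_prob P a \<ge> real N powr (\<epsilon> - 1)}) \<le> 1 / real N powr (\<epsilon> - 1)"
        using N by (intro card_likely_words) simp
      also have "\<dots> = real N powr (1 - \<epsilon>)" by (simp add: powr_minus_divide[symmetric])
      also have "\<dots> \<le> real N powr 1" using N \<epsilon> by (intro powr_mono) auto
      finally show "real (card {a. length a = n \<and> word_prob P a \<ge> real N powr (\<epsilon> - 1)}) \<le> real N"
        using N by simp
    qed
    also have "\<dots> = real (D N) * real N" by simp
    also have "\<dots> \<le> (C * ln (real N) + 1) * real N"
      using L by (intro mult_right_mono) (auto simp: D_def of_nat_floor)
    finally show ?thesis .
  qed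
  have miss: "prob {x. \<not> sublist a (initial_word x N)} \<le> h N" if a: "a \<in> A N" and N: "N \<ge> 1" for a N
  proof -
    define n where "n = length a"
    have n: "n \<ge> 1" "real n \<le> C * ln (real N) + 1" "word_prob P a \<ge> real N powr (\<epsilon> - 1)"
      using a by (auto simp: A_def n_def)
    have "0 < real N powr (\<epsilon> - 1)" using N by simp
    also note n(3)
    finally have supp: "a \<in> supp_words P n" by (simp add: supp_words_def n_def)
    define \<kappa> where "\<kappa> = exp (- k n) * word_prob P a"
    have \<kappa>: "0 \<le> \<kappa>" "\<kappa> \<le> 1"
      using k(1)[OF n(1)] by (auto simp: \<kappa>_def intro!: mult_le_one)
    define j where "j = (N - 1) div (n + \<tau>)"
    have "j * (n + \<tau>) \<le> N - 1" unfolding j_def by (rule div_times_less_eq_dividend)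
    then have jN: "1 + j * (n + \<tau>) \<le> N" using N by linarith
    have "prob {x. \<not> sublist a (initial_word x N)} \<le> exp (- real j * \<kappa> / (real \<tau> + 1))"
      using lower[OF n(1) _ supp] jN
      by (intro prob_avoids_le \<kappa>) (auto simp: \<kappa>_def n_def)
    also have "\<dots> \<le> h N"
    proof -
      have "k n \<le> \<eta> * (C * ln (real N) + 1) + c"
        using c(2)[of n] mult_left_mono[OF n(2), of \<eta>] \<eta> by linarith
      also have "\<dots> = (\<epsilon> / 2) * ln (real N) + (\<eta> + c)"
        using C by (simp add: \<eta>_def field_simps)
      finally have "exp (- k n) \<ge> exp (- ((\<epsilon> / 2) * ln (real N) + (\<eta> + c)))" by simp
      also have "exp (- ((\<epsilon> / 2) * ln (real N) + (\<eta> + c))) = real N powr (- \<epsilon> / 2) * exp (- (\<eta> + c))"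
        using N by (simp add: powr_def exp_add[symmetric])
      finally have "\<kappa> \<ge> (real N powr (- \<epsilon> / 2) * exp (- (\<eta> + c))) * real N powr (\<epsilon> - 1)"
        unfolding \<kappa>_def using n(3) by (intro mult_mono) auto
      also have "(real N powr (- \<epsilon> / 2) * exp (- (\<eta> + c))) * real N powr (\<epsilon> - 1)
          = exp (- (\<eta> + c)) * (real N powr (- \<epsilon> / 2) * real N powr (\<epsilon> - 1))" by (simp only: ac_simps)
      also have "real N powr (- \<epsilon> / 2) * real N powr (\<epsilon> - 1) = real N powr (\<epsilon> / 2 - 1)"
        by (simp add: powr_add[symmetric])
      finally have \<kappa>2: "\<kappa> / (real \<tau> + 1) \<ge> c2 * real N powr (\<epsilon> / 2 - 1)"
        by (simp add: c2_def divide_right_mono)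
      have "N - 1 < (n + \<tau>) + j * (n + \<tau>)"
        unfolding j_def using n(1) by (intro dividend_less_div_times) simp
      then have "real (N - 1) < real ((n + \<tau>) + j * (n + \<tau>))" by (rule of_nat_less_iff[THEN iffD2])
      then have "real (N - 1) / real (n + \<tau>) - 1 \<le> real j"
        using n(1) by (simp add: field_simps)
      moreover have "(real N - 1) / (C * ln (real N) + 1 + real \<tau>) \<le> real (N - 1) / real (n + \<tau>)"
        using n N by (auto simp: of_nat_diff intro!: divide_left_mono mult_pos_pos)
      ultimately have j: "(real N - 1) / (C * ln (real N) + 1 + real \<tau>) - 1 \<le> real j" by linarith
      have "((real N - 1) / (C * ln (real N) + 1 + real \<tau>) - 1) * (c2 * real N powr (\<epsilon> / 2 - 1))
          \<le> real j * (\<kappa> / (real \<tau> + 1))"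
        using c2 by (intro mult_mono[OF j \<kappa>2]) auto
      then show ?thesis by (simp add: h_def)
    qed
    finally show ?thesis .
  qed
  have F_sets: "F N \<in> events" for N
    unfolding F_def by (intro sets.finite_UN finA) simp
  have F_le: "prob (F N) \<le> ((C * ln (real N) + 1) * real N) * h N" if N: "N \<ge> 1" for N
  proof -
    have "prob (F N) \<le> (\<Sum>a\<in>A N. prob {x. \<not> sublist a (initial_word x N)})"
      unfolding F_def by (intro finite_measure_subadditive_finite finA) auto
    also have "\<dots> \<le> (\<Sum>a\<in>A N. h N)" by (intro sum_mono miss N)
    also have "\<dots> = real (card (A N)) * h N" by simp
    also have "\<dots> \<le> ((C * ln (real N) + 1) * real N) * h N"
      by (intro mult_right_mono cardA N) (simp add: h_def)
    finally show ?thesis .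
  qed
  have "\<forall>\<^sub>F N in sequentially. ((C * ln (real N) + 1) * real N) * h N \<le> 1 / real N ^ 2"
    unfolding h_def using C \<epsilon> c2 by real_asymp
  then have "\<forall>\<^sub>F N in sequentially. prob (F N) \<le> 1 / real N ^ 2"
    using eventually_ge_at_top[of 1] by eventually_elim (use F_le in \<open>force intro: order_trans\<close>)
  then have "AE x in P. \<forall>\<^sub>F N in sequentially. x \<notin> F N"
    by (rule AE_eventually_not_in[OF F_sets]) (use inverse_power_summable[of 2, where 'a = real] in \<open>simp add: field_simps\<close>)
  then show ?thesis
    by eventually_elim (auto simp: F_def A_def elim!: eventually_mono)
qed

end

section \<open>Matches between independent sequences\<close>

locale stationary_pair = P: stationary P + Q: stationary Q
  for P Q :: "(nat \<Rightarrow> 'a::finite) measure"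

sublocale stationary_pair \<subseteq> PQ: pair_prob_space P Q ..

context stationary_pair
begin

lemma AE_fst:
  assumes "AE x in P. R x"
  shows "AE p in P \<Otimes>\<^sub>M Q. R (fst p)"
proof -
  from assms obtain Z where Z: "{x \<in> space P. \<not> R x} \<subseteq> Z" "emeasure P Z = 0" "Z \<in> sets P"
    by (rule AE_E)
  show ?thesis
  proof (rule AE_I)
    show "{p \<in> space (P \<Otimes>\<^sub>M Q). \<not> R (fst p)} \<subseteq> Z \<times> space Q"
      using Z(1) by (auto simp: space_pair_measure)
    show "Z \<times> space Q \<in> sets (P \<Otimes>\<^sub>M Q)"
      by (intro pair_measureI Z sets.top)
    show "emeasure (P \<Otimes>\<^sub>M Q) (Z \<times> space Q) = 0"
      using Z sets.top[of P] sets.top[of Q] by (subst Q.emeasure_pair_measure_Times) auto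
  qed
qed

lemma AE_snd:
  assumes "AE y in Q. R y"
  shows "AE p in P \<Otimes>\<^sub>M Q. R (snd p)"
proof -
  from assms obtain Z where Z: "{x \<in> space Q. \<not> R x} \<subseteq> Z" "emeasure Q Z = 0" "Z \<in> sets Q"
    by (rule AE_E)
  show ?thesis
  proof (rule AE_I)
    show "{p \<in> space (P \<Otimes>\<^sub>M Q). \<not> R (snd p)} \<subseteq> space P \<times> Z"
      using Z(1) by (auto simp: space_pair_measure)
    show "space P \<times> Z \<in> sets (P \<Otimes>\<^sub>M Q)"
      by (intro pair_measureI Z sets.top)
    show "emeasure (P \<Otimes>\<^sub>M Q) (space P \<times> Z) = 0"
      using Z sets.top[of P] sets.top[of Q] by (subst Q.emeasure_pair_measure_Times) auto
  qed
qed

text \<open>Independence enters here. With \<open>y\<close> frozen its words are fixed, so their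
  occurrence in \<open>x\<close> is an event for \<open>P\<close> alone, to which
  \<open>P.prob_occurs_le\<close> applies.\<close>

lemma measure_le_integral_slices:
  fixes f :: "(nat \<Rightarrow> 'a) \<Rightarrow> real"
  assumes A: "A \<in> sets (P \<Otimes>\<^sub>M Q)" and f: "integrable Q f"
    and slice: "\<And>y. measure P {x. (x, y) \<in> A} \<le> f y"
  shows "measure (P \<Otimes>\<^sub>M Q) A \<le> (\<integral>y. f y \<partial>Q)"
proof -
  have f0: "0 \<le> f y" for y using slice[of y] measure_nonneg order_trans by blast
  have "emeasure (P \<Otimes>\<^sub>M Q) A = (\<integral>\<^sup>+y. emeasure P ((\<lambda>x. (x, y)) -` A) \<partial>Q)"
    by (rule PQ.emeasure_pair_measure_alt2[OF A])
  also have "\<dots> \<le> (\<integral>\<^sup>+y. ennreal (f y) \<partial>Q)"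
    using slice by (intro nn_integral_mono) (auto simp: P.emeasure_eq_measure vimage_def intro: ennreal_leI)
  also have "\<dots> = ennreal (\<integral>y. f y \<partial>Q)"
    using f f0 by (intro nn_integral_eq_integral) auto
  finally show ?thesis
    using f0 by (simp add: PQ.P.emeasure_eq_measure integral_nonneg_AE)
qed

lemma events_pair [measurable]:
  "{p. R (initial_word (fst p) N) (subword (snd p) j n)} \<in> sets (P \<Otimes>\<^sub>M Q)"
proof -
  let ?f = "\<lambda>p :: (nat \<Rightarrow> 'a) \<times> (nat \<Rightarrow> 'a). (initial_word (fst p) N, subword (snd p) j n)"
  have "?f \<in> measurable (P \<Otimes>\<^sub>M Q) (count_space UNIV \<Otimes>\<^sub>M count_space UNIV)" by measurable
  then have "?f -` {w. R (fst w) (snd w)} \<inter> space (P \<Otimes>\<^sub>M Q) \<in> sets (P \<Otimes>\<^sub>M Q)"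
    by (rule measurable_sets) (subst pair_measure_countable, auto)
  also have "?f -` {w. R (fst w) (snd w)} \<inter> space (P \<Otimes>\<^sub>M Q)
      = {p. R (initial_word (fst p) N) (subword (snd p) j n)}"
    by (auto simp: space_pair_measure)
  finally show ?thesis .
qed

text \<open>At -1 the pressure is built from the probability that independent samples of
  \<open>P\<close> and \<open>Q\<close> share their first \<open>n\<close> letters; a negative
  limsup means exponential decay. A vanishing sum has pressure -\<infinity> and is treated
  apart.\<close>

lemma nondegenerate_exp_bound:
  assumes "nondegenerate_pair P Q"
  shows "\<exists>\<gamma>>0. \<forall>\<^sub>F n in sequentially.
    (\<Sum>a | length a = n. word_prob Q a * word_prob P a) \<le> exp (- \<gamma> * real n)"
proof -
  from assms have "limsup (\<lambda>n. cross_pressure_n P Q n (-1) / ereal (real n)) < 0"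
    by (simp add: nondegenerate_pair_def upper_cross_pressure_def)
  from ereal_dense2[OF this] obtain c where
    c: "limsup (\<lambda>n. cross_pressure_n P Q n (-1) / ereal (real n)) < ereal c" "ereal c < 0" by blast
  from c(1) have "\<forall>\<^sub>F n in sequentially. cross_pressure_n P Q n (-1) / ereal (real n) < ereal c"
    by (rule Limsup_lessD)
  then have "\<forall>\<^sub>F n in sequentially.
      (\<Sum>a | length a = n. word_prob Q a * word_prob P a) \<le> exp (- (- c) * real n)"
    using eventually_gt_at_top[of 0]
  proof eventually_elim
    case (elim n)
    let ?s = "\<Sum>a\<in>supp_words P n. word_prob P a powr (- (-1)) * word_prob Q a"
    have "?s = (\<Sum>a\<in>supp_words P n. word_prob Q a * word_prob P a)"
      by (intro sum.cong) (auto simp: mult.commute)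
    also have "\<dots> = (\<Sum>a | length a = n. word_prob Q a * word_prob P a)"
      using finite_words[of n "\<lambda>_. True"]
      by (intro sum.mono_neutral_left) (auto simp: supp_words_def less_le)
    finally have s: "?s = (\<Sum>a | length a = n. word_prob Q a * word_prob P a)" .
    have s0: "?s \<ge> 0" by (intro sum_nonneg) auto
    show ?case
    proof (cases "?s = 0")
      case True
      then show ?thesis using s by simp
    next
      case False
      then have "cross_pressure_n P Q n (-1) = ereal (ln ?s)"
        unfolding cross_pressure_n_def eln_def by simp
      with elim have "ln ?s / real n < c" by simp
      then have "ln ?s < c * real n" using elim(2) by (simp add: field_simps)
      then have "?s < exp (c * real n)" using False s0 by (metis exp_less_mono exp_ln less_le)
      then show ?thesis using s by simp
    qed
  qed
  moreover have "- c > 0" using c(2) by simp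
  ultimately show ?thesis by blast
qed

text \<open>It is enough to exclude one critical length \<open>n N\<close>: a longer match has a
  prefix of that length which also matches.\<close>

lemma AE_match_length:
  assumes "nondegenerate_pair P Q"
  shows "\<exists>C>0. AE p in P \<Otimes>\<^sub>M Q. \<forall>\<^sub>F N in sequentially. \<forall>j\<le>N. \<forall>n.
    sublist (subword (snd p) j n) (initial_word (fst p) N) \<longrightarrow> real n \<le> C * ln (real N)"
proof -
  obtain \<gamma> where \<gamma>: "\<gamma> > 0" and exp_bound: "\<forall>\<^sub>F n in sequentially.
    (\<Sum>a | length a = n. word_prob Q a * word_prob P a) \<le> exp (- \<gamma> * real n)"
    using nondegenerate_exp_bound[OF assms] by blast
  \<comment> \<open>The constant 4 makes the coincidence probability at most N^(-4), so that (N +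
    1)^2 pairs of positions still leave a summable bound of order N^(-2).\<close>
  define n where "n N = nat \<lceil>4 / \<gamma> * ln (real N)\<rceil>" for N
  define A where "A N = (\<Union>j\<le>N. {p :: (nat \<Rightarrow> 'a) \<times> (nat \<Rightarrow> 'a). sublist (subword (snd p) j (n N)) (initial_word (fst p) N)})" for N
  have A_sets: "A N \<in> sets (P \<Otimes>\<^sub>M Q)" for N
    unfolding A_def by (intro sets.finite_UN events_pair) auto
  have n_top: "filterlim n at_top sequentially"
    unfolding n_def using \<gamma> by real_asymp
  have n_ge: "real (n N) \<ge> 4 / \<gamma> * ln (real N)" for N
    unfolding n_def by (rule real_nat_ceiling_ge)
  have A_le: "measure (P \<Otimes>\<^sub>M Q) (A N)
      \<le> (real N + 1)\<^sup>2 * (\<Sum>a | length a = n N. word_prob Q a * word_prob P a)" for N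
  proof -
    have int: "integrable Q (\<lambda>y. (real N + 1) * word_prob P (subword y j (n N)))" for j
      by (rule Q.integrable_const_bound[where B = "real N + 1"])
        (auto simp: abs_mult intro!: mult_left_le)
    have "measure (P \<Otimes>\<^sub>M Q) (A N)
        \<le> (\<integral>y. (\<Sum>j\<le>N. (real N + 1) * word_prob P (subword y j (n N))) \<partial>Q)"
    proof (rule measure_le_integral_slices[OF A_sets])
      show "integrable Q (\<lambda>y. \<Sum>j\<le>N. (real N + 1) * word_prob P (subword y j (n N)))"
        using int by simp
      fix y
      have "{x. (x, y) \<in> A N} = (\<Union>j\<le>N. {x. sublist (subword y j (n N)) (initial_word x N)})"
        by (auto simp: A_def)
      also have "measure P \<dots> \<le> (\<Sum>j\<le>N. measure P {x. sublist (subword y j (n N)) (initial_word x N)})"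
        by (intro P.finite_measure_subadditive_finite) auto
      also have "\<dots> \<le> (\<Sum>j\<le>N. (real N + 1) * word_prob P (subword y j (n N)))"
        by (intro sum_mono P.prob_occurs_le)
      finally show "measure P {x. (x, y) \<in> A N} \<le> (\<Sum>j\<le>N. (real N + 1) * word_prob P (subword y j (n N)))" .
    qed
    also have "\<dots> = (\<Sum>j\<le>N. (real N + 1) * (\<integral>y. word_prob P (subword y j (n N)) \<partial>Q))"
      using int by (subst Bochner_Integration.integral_sum) auto
    also have "\<dots> = (real N + 1)\<^sup>2 * (\<Sum>a | length a = n N. word_prob Q a * word_prob P a)"
      by (simp add: Q.integral_subword power2_eq_square)
    finally show ?thesis .
  qed
  have "\<forall>\<^sub>F N in sequentially. measure (P \<Otimes>\<^sub>M Q) (A N) \<le> 4 * inverse (real N ^ 2)"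
    using filterlim_iff[THEN iffD1, OF n_top, rule_format, OF exp_bound] eventually_ge_at_top[of 1]
  proof eventually_elim
    case (elim N)
    have "exp (- \<gamma> * real (n N)) \<le> exp (- (4 * ln (real N)))"
      using mult_left_mono[OF n_ge[of N], of \<gamma>] \<gamma> by simp
    also have "\<dots> = inverse (real N ^ 4)"
      using elim(2) by (simp add: exp_minus powr_def flip: powr_numeral)
    finally have "measure (P \<Otimes>\<^sub>M Q) (A N) \<le> (real N + 1)\<^sup>2 * inverse (real N ^ 4)"
      using A_le[of N] elim(1) mult_left_mono[of _ "inverse (real N ^ 4)" "(real N + 1)\<^sup>2"]
      by (meson order_trans zero_le_power2)
    also have "\<dots> \<le> (2 * real N)\<^sup>2 * inverse (real N ^ 4)"
      using elim(2) by (intro mult_right_mono power_mono) auto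
    also have "\<dots> = 4 * inverse (real N ^ 2)"
      using elim(2) by (simp add: field_simps power2_eq_square power4_eq_xxxx)
    finally show ?case .
  qed
  then have "AE p in P \<Otimes>\<^sub>M Q. \<forall>\<^sub>F N in sequentially. p \<notin> A N"
    by (rule PQ.P.AE_eventually_not_in[OF A_sets])
      (intro summable_mult inverse_power_summable, simp)
  then have "AE p in P \<Otimes>\<^sub>M Q. \<forall>\<^sub>F N in sequentially. \<forall>j\<le>N. \<forall>n.
    sublist (subword (snd p) j n) (initial_word (fst p) N) \<longrightarrow> real n \<le> (4 / \<gamma> + 1) * ln (real N)"
  proof eventually_elim
    case (elim p)
    have "\<forall>\<^sub>F N in sequentially. ln (real N) \<ge> 1" by real_asymp
    with elim show ?case
    proof eventually_elim
      case (elim N)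
      show ?case
      proof (intro allI impI)
        fix j m assume j: "j \<le> N" and m: "sublist (subword (snd p) j m) (initial_word (fst p) N)"
        have "m < n N"
        proof (rule ccontr)
          assume "\<not> m < n N"
          with sublist_subword_mono[OF _ m, of "n N"]
          have "sublist (subword (snd p) j (n N)) (initial_word (fst p) N)" by simp
          with j elim(1) show False by (auto simp: A_def)
        qed
        then have "real m \<le> 4 / \<gamma> * ln (real N)"
          unfolding n_def by linarith
        then show "real m \<le> (4 / \<gamma> + 1) * ln (real N)"
          using elim(2) by (simp add: algebra_simps)
      qed
    qed
  qed
  moreover have "4 / \<gamma> + 1 > 0" using \<gamma> by (simp add: add_pos_pos)
  ultimately show ?thesis by blast
qed

text \<open>Threshold, number of starts and length of the window of \<open>x\<close> are separate
  parameters, so that monotonicity in each of them permits a comparison of N with neighbouring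
  powers of 2.\<close>

definition unlikely_matches ::
  "real \<Rightarrow> nat \<Rightarrow> nat \<Rightarrow> (nat \<Rightarrow> 'a) \<Rightarrow> (nat \<Rightarrow> 'a) \<Rightarrow> nat set" where
  "unlikely_matches t N M x y = {j. j < N \<and>
     (\<exists>n. word_prob P (subword y j n) \<le> t \<and> sublist (subword y j n) (initial_word x M))}"

lemma unlikely_matches_mono:
  "t \<le> t' \<Longrightarrow> N \<le> N' \<Longrightarrow> M \<le> M' \<Longrightarrow> unlikely_matches t N M x y \<subseteq> unlikely_matches t' N' M' x y"
  unfolding unlikely_matches_def
  by (blast intro: order_trans less_le_trans sublist_initial_word_mono)

text \<open>Expected count by Fubini, then Markov. The expectation carries no factor for the number
  of admissible lengths, since one critical prefix per start decides the matter.\<close>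

lemma prob_many_unlikely_matches:
  assumes s: "s > 0" and t: "t \<ge> 0"
  shows "{p. real (card (unlikely_matches t N M (fst p) (snd p))) \<ge> s} \<in> sets (P \<Otimes>\<^sub>M Q)"
    and "measure (P \<Otimes>\<^sub>M Q) {p. real (card (unlikely_matches t N M (fst p) (snd p))) \<ge> s}
      \<le> real N * (real M + 1) * t / s"
proof -
  define B where "B j = (\<Union>n. {p. word_prob P (subword (snd p) j n) \<le> t
    \<and> sublist (subword (snd p) j n) (initial_word (fst p) M)})" for j
  have B_sets [measurable]: "B j \<in> sets (P \<Otimes>\<^sub>M Q)" for j
    unfolding B_def by (intro sets.countable_UN'' events_pair) auto
  define X where "X p = (\<Sum>j<N. indicat_real (B j) p)" for p
  have X: "real (card (unlikely_matches t N M (fst p) (snd p))) = X p" for p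
  proof -
    have "unlikely_matches t N M (fst p) (snd p) = {..<N} \<inter> {j. p \<in> B j}"
      by (auto simp: unlikely_matches_def B_def)
    then show ?thesis by (simp add: X_def indicator_def sum.If_cases)
  qed
  have X_meas [measurable]: "X \<in> borel_measurable (P \<Otimes>\<^sub>M Q)"
    unfolding X_def by measurable
  have "{p \<in> space (P \<Otimes>\<^sub>M Q). X p \<ge> s} \<in> sets (P \<Otimes>\<^sub>M Q)" by measurable
  then show "{p. real (card (unlikely_matches t N M (fst p) (snd p))) \<ge> s} \<in> sets (P \<Otimes>\<^sub>M Q)"
    by (simp add: X space_pair_measure)
  have B_le: "measure (P \<Otimes>\<^sub>M Q) (B j) \<le> (real M + 1) * t" for j
  proof -
    have "measure (P \<Otimes>\<^sub>M Q) (B j) \<le> (\<integral>y. (real M + 1) * t \<partial>Q)"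
    proof (rule measure_le_integral_slices[OF B_sets])
      fix y
      show "measure P {x. (x, y) \<in> B j} \<le> (real M + 1) * t"
      proof (cases "\<exists>n. word_prob P (subword y j n) \<le> t")
        case False
        then have "{x. (x, y) \<in> B j} = {}" by (auto simp: B_def)
        then show ?thesis using t by simp
      next
        case True
        \<comment> \<open>The shortest prefix of probability at most \<open>t\<close> occurs whenever a longer one does.\<close>
        define m where "m = (LEAST n. word_prob P (subword y j n) \<le> t)"
        have m: "word_prob P (subword y j m) \<le> t"
          unfolding m_def by (rule LeastI_ex[OF True])
        have "{x. (x, y) \<in> B j} \<subseteq> {x. sublist (subword y j m) (initial_word x M)}"
        proof clarsimp
          fix x assume "(x, y) \<in> B j"
          then obtain n where n: "word_prob P (subword y j n) \<le> t"
            "sublist (subword y j n) (initial_word x M)" by (auto simp: B_def)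
          have "m \<le> n" unfolding m_def by (rule Least_le) (rule n(1))
          then show "sublist (subword y j m) (initial_word x M)"
            using n(2) by (rule sublist_subword_mono)
        qed
        then have "measure P {x. (x, y) \<in> B j} \<le> measure P {x. sublist (subword y j m) (initial_word x M)}"
          by (intro P.finite_measure_mono) auto
        also have "\<dots> \<le> (real M + 1) * word_prob P (subword y j m)" by (rule P.prob_occurs_le)
        also have "\<dots> \<le> (real M + 1) * t" by (intro mult_left_mono m) simp
        finally show ?thesis .
      qed
    qed simp
    then show ?thesis using Q.prob_space by simp
  qed
  have int: "integrable (P \<Otimes>\<^sub>M Q) (\<lambda>p. indicat_real (B j) p)" for j
    by (rule PQ.P.integrable_const_bound[where B = 1]) (auto simp: indicator_def)
  have "measure (P \<Otimes>\<^sub>M Q) {p \<in> space (P \<Otimes>\<^sub>M Q). X p \<ge> s} \<le> (\<integral>p. X p \<partial>(P \<Otimes>\<^sub>M Q)) / s"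
    by (rule integral_Markov_inequality_measure[where A = "{}"])
      (use s int in \<open>auto simp: X_def intro!: sum_nonneg\<close>)
  also have "(\<integral>p. X p \<partial>(P \<Otimes>\<^sub>M Q)) = (\<Sum>j<N. measure (P \<Otimes>\<^sub>M Q) (B j))"
    unfolding X_def using int by (subst Bochner_Integration.integral_sum) auto
  also have "\<dots> \<le> (\<Sum>j<N. (real M + 1) * t)" by (intro sum_mono B_le)
  also have "\<dots> = real N * (real M + 1) * t" by simp
  finally show "measure (P \<Otimes>\<^sub>M Q) {p. real (card (unlikely_matches t N M (fst p) (snd p))) \<ge> s}
      \<le> real N * (real M + 1) * t / s"
    using s by (simp add: X space_pair_measure divide_right_mono)
qed

lemma AE_few_unlikely_matches:
  assumes \<epsilon>: "0 < \<epsilon>" "\<epsilon> \<le> 1"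
  shows "AE p in P \<Otimes>\<^sub>M Q. \<forall>\<^sub>F N in sequentially.
    real (card (unlikely_matches (real N powr (- 1 - \<epsilon>)) N N (fst p) (snd p))) \<le> real N powr (1 - \<epsilon> / 2)"
proof -
  \<comment> \<open>For N between 2^k and 2^(k+1), threshold and allowed count are taken at the left
    end and both windows at the right end, so each change goes in the safe direction. Allowing
    N^(1-\<epsilon>/2) instead of the expected N^(1-\<epsilon>) leaves a factor N^(-\<epsilon>/2),
    geometric in \<open>k\<close>.\<close>
  define t where "t k = (2 ^ k) powr (- 1 - \<epsilon>)" for k :: nat
  define s where "s k = (2 ^ k) powr (1 - \<epsilon> / 2)" for k :: nat
  define U where "U k p = unlikely_matches (t k) (2 * 2 ^ k) (2 * 2 ^ k) (fst p) (snd p)" for k p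
  define A where "A k = {p. real (card (U k p)) \<ge> s k}" for k
  have ts: "t k \<ge> 0" "s k > 0" for k by (auto simp: t_def s_def)
  \<comment> \<open>Markov's inequality is summable only along \<open>N = 2 ^ k\<close>; monotonicity fills the gaps.\<close>
  have A_le: "measure (P \<Otimes>\<^sub>M Q) (A k) \<le> 6 * (2 powr (- \<epsilon> / 2)) ^ k" for k
  proof -
    define M :: real where "M = 2 ^ k"
    have M: "M \<ge> 1" by (simp add: M_def)
    have "measure (P \<Otimes>\<^sub>M Q) (A k) \<le> real (2 * 2 ^ k) * (real (2 * 2 ^ k) + 1) * t k / s k"
      unfolding A_def U_def by (rule prob_many_unlikely_matches(2)) (use ts in auto)
    also have "\<dots> = 2 * M * (2 * M + 1) * M powr (- 1 - \<epsilon>) / M powr (1 - \<epsilon> / 2)"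
      by (simp add: M_def t_def s_def)
    also have "\<dots> \<le> 2 * M * (3 * M) * M powr (- 1 - \<epsilon>) / M powr (1 - \<epsilon> / 2)"
      using M by (intro divide_right_mono mult_right_mono mult_left_mono) auto
    also have "\<dots> = 6 * (M powr 1 * M powr 1 * M powr (- 1 - \<epsilon>) / M powr (1 - \<epsilon> / 2))"
      using M by simp
    also have "M powr 1 * M powr 1 * M powr (- 1 - \<epsilon>) / M powr (1 - \<epsilon> / 2) = M powr (- \<epsilon> / 2)"
      by (simp only: powr_add[symmetric] powr_diff[symmetric]) (simp add: field_simps)
    also have "M powr (- \<epsilon> / 2) = (2 powr (- \<epsilon> / 2)) ^ k"
      by (simp add: M_def powr_power powr_realpow[symmetric] powr_powr mult.commute)
    finally show ?thesis .
  qed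
  have "(2::real) powr (- \<epsilon> / 2) < 2 powr 0"
    using \<epsilon> by (intro powr_less_mono) auto
  then have "summable (\<lambda>k. 6 * ((2::real) powr (- \<epsilon> / 2)) ^ k)"
    by (intro summable_mult summable_geometric) simp
  moreover have "A k \<in> sets (P \<Otimes>\<^sub>M Q)" for k
    unfolding A_def U_def by (rule prob_many_unlikely_matches(1)) (use ts in auto)
  ultimately have "AE p in P \<Otimes>\<^sub>M Q. \<forall>\<^sub>F k in sequentially. p \<notin> A k"
    using A_le by (intro PQ.P.AE_eventually_not_in[where b = "\<lambda>k. 6 * (2 powr (- \<epsilon> / 2)) ^ k"]) auto
  then show ?thesis
  proof eventually_elim
    case (elim p)
    then obtain K where K: "\<And>k. k \<ge> K \<Longrightarrow> p \<notin> A k" by (auto simp: eventually_sequentially)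
    show ?case
      unfolding eventually_sequentially
    proof (intro exI[of _ "2 ^ K"] allI impI)
      fix N :: nat assume N: "2 ^ K \<le> N"
      then have N1: "N \<ge> 1" by (metis one_le_numeral one_le_power order_trans)
      obtain k where k: "2 ^ k \<le> N" "N < 2 ^ (k + 1)"
        using ex_power_ivl1[of 2 N] N1 by auto
      have "(2::nat) ^ K < 2 ^ (k + 1)" using N k(2) by linarith
      then have "K < k + 1" by (rule power_less_imp_less_exp[rotated]) simp
      then have "K \<le> k" by simp
      have kN: "2 ^ k \<le> real N" using k(1) by (metis of_nat_le_iff of_nat_numeral of_nat_power)
      have "unlikely_matches (real N powr (- 1 - \<epsilon>)) N N (fst p) (snd p) \<subseteq> U k p"
        unfolding U_def
      proof (rule unlikely_matches_mono)
        show "real N powr (- 1 - \<epsilon>) \<le> t k"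
          unfolding t_def using kN \<epsilon> by (intro powr_mono2') auto
      qed (use k in auto)
      then have "card (unlikely_matches (real N powr (- 1 - \<epsilon>)) N N (fst p) (snd p)) \<le> card (U k p)"
        by (rule card_mono[rotated]) (auto simp: U_def unlikely_matches_def)
      also have "real (card (U k p)) \<le> s k" using K[OF \<open>K \<le> k\<close>] by (simp add: A_def)
      also have "s k \<le> real N powr (1 - \<epsilon> / 2)"
        unfolding s_def using kN \<epsilon> by (intro powr_mono2) auto
      finally show "real (card (unlikely_matches (real N powr (- 1 - \<epsilon>)) N N (fst p) (snd p)))
          \<le> real N powr (1 - \<epsilon> / 2)" by simp
    qed
  qed
qed

end

section \<open>The weak Gibbs potential\<close>

context stationary
begin

lemma word_prob_Nil [simp]: "word_prob P [] = 1"
  using prob_space by (simp add: word_prob_def cylinder_def initial_word_def)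

text \<open>By invariance a window at \<open>j\<close> is at least as probable as the prefix that
  contains it. This guarantees that no logarithm taken along \<open>y\<close> is the default
  \<open>ln 0\<close>.\<close>

lemma supp_seqs_subword_pos:
  assumes "y \<in> supp_seqs P"
  shows "word_prob P (subword y j n) > 0"
proof -
  have "0 < word_prob P (initial_word y (j + n))"
    using assms by (simp add: supp_seqs_def)
  also have "\<dots> \<le> prob {x. subword x j (length (subword y j n)) = subword y j n}"
    unfolding word_prob_def
    by (intro finite_measure_mono events_subword) (auto simp: cylinder_def initial_word_def subword_def)
  finally show ?thesis by (simp only: prob_word_at)
qed

lemma word_prob_pos_supp_seqs:
  assumes "word_prob P a > 0"
  obtains y where "y \<in> supp_seqs P" "initial_word y (length a) = a"
proof -
  have "\<exists>y\<in>supp_seqs P. y \<in> cylinder a"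
  proof (rule ccontr)
    assume "\<not> ?thesis"
    then have "AE y in P. y \<notin> cylinder a"
      using AE_supp_seqs by (auto elim: eventually_mono)
    then show False using assms prob_eq_0[of "cylinder a"] by (simp add: word_prob_def)
  qed
  then show thesis using that by (auto simp: cylinder_def)
qed

text \<open>The Gibbs bounds are assumed on the subshift only; this makes them available at every
  point of the support and not just almost everywhere.\<close>

lemma supp_seqs_subset_closed:
  assumes "closedin seq_topology \<Omega>" "prob \<Omega> = 1"
  shows "supp_seqs P \<subseteq> \<Omega>"
proof
  fix y assume y: "y \<in> supp_seqs P"
  \<comment> \<open>\<open>measure\<close> is 0 outside the sigma-algebra, so the value 1 forces
    measurability.\<close>
  have "\<Omega> \<in> events"
    using assms(2) measure_notin_sets[of \<Omega> P] by fastforce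
  then have ae: "AE x in P. x \<in> \<Omega>" using assms(2) prob_eq_1 by blast
  show "y \<in> \<Omega>"
  proof (rule closedin_seq_topology_cylinderI[OF assms(1)])
    fix n
    show "cylinder (initial_word y n) \<inter> \<Omega> \<noteq> {}"
    proof
      assume "cylinder (initial_word y n) \<inter> \<Omega> = {}"
      with ae have "AE x in P. x \<notin> cylinder (initial_word y n)"
        by (auto elim: eventually_mono)
      then have "word_prob P (initial_word y n) = 0"
        using prob_eq_0 by (simp add: word_prob_def)
      with y show False by (auto simp: supp_seqs_def dest: spec[of _ n])
    qed
  qed
qed

text \<open>Taking logarithms replaces the factor \<open>K n\<close> by an error of at most \<eta> n
  + c. The start \<open>j\<close> is free because the subshift is forward invariant, so the bound
  can be used at the shifted point.\<close>

lemma weak_Gibbs_potential: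
  assumes "weak_Gibbs P"
  obtains g :: "(nat \<Rightarrow> 'a) \<Rightarrow> real" and B where
    "g \<in> borel_measurable P" "\<And>y. \<bar>g y\<bar> \<le> B"
    "\<And>\<eta>. \<eta> > 0 \<Longrightarrow> \<exists>c. \<forall>y\<in>supp_seqs P. \<forall>j n.
       \<bar>ln (word_prob P (subword y j n)) + birkhoff_sum g n ((shift ^^ j) y)\<bar> \<le> \<eta> * real n + c"
proof -
  from assms obtain \<Omega> :: "(nat \<Rightarrow> 'a) set" and \<phi> :: "(nat \<Rightarrow> 'a) \<Rightarrow> real" and K :: "nat \<Rightarrow> real"
    where sub: "is_subshift \<Omega>" and one: "measure P \<Omega> = 1"
      and cont: "continuous_map (subtopology seq_topology \<Omega>) euclideanreal \<phi>"
      and K: "\<And>n. n \<ge> 1 \<Longrightarrow> K n > 0" and K_o: "(\<lambda>n. ln (K n)) \<in> o(\<lambda>n. real n)"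
      and gibbs: "\<And>y n. y \<in> \<Omega> \<Longrightarrow> n \<ge> 1 \<Longrightarrow>
           inverse (K n) * exp (birkhoff_sum \<phi> n y - real n * top_pressure \<Omega> \<phi>)
             \<le> word_prob P (initial_word y n) \<and>
           word_prob P (initial_word y n)
             \<le> K n * exp (birkhoff_sum \<phi> n y - real n * top_pressure \<Omega> \<phi>)"
    unfolding weak_Gibbs_def by blast
  define p where "p = top_pressure \<Omega> \<phi>"
  have closed: "closedin seq_topology \<Omega>" and inv: "shift ` \<Omega> \<subseteq> \<Omega>"
    using sub by (auto simp: is_subshift_def)
  have inv': "(shift ^^ j) y \<in> \<Omega>" if "y \<in> \<Omega>" for j y
    using that inv by (induction j) auto
  \<comment> \<open>The potential with pressure absorbed and sign reversed. The value 0 off the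
    subshift makes it total and bounded; orbits of support points never see it.\<close>
  define g where "g y = (if y \<in> \<Omega> then p - \<phi> y else 0)" for y
  have \<Omega>_sets: "\<Omega> \<in> events"
    using one measure_notin_sets[of \<Omega> P] by fastforce
  have pre: "{y \<in> \<Omega>. \<phi> y \<in> S} \<in> events" if "open S" for S
  proof -
    have "openin (subtopology seq_topology \<Omega>) {y \<in> topspace (subtopology seq_topology \<Omega>). \<phi> y \<in> S}"
      using cont that by (intro openin_continuous_map_preimage) auto
    then obtain U where "openin seq_topology U" "{y \<in> \<Omega>. \<phi> y \<in> S} = U \<inter> \<Omega>"
      by (auto simp: openin_subtopology)
    then show ?thesis using openin_seq_topology_sets \<Omega>_sets by (auto simp: sets_P)
  qed
  have g_meas: "g \<in> borel_measurable P"
  proof (rule borel_measurableI)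
    fix S :: "real set" assume S: "open S"
    have "open ((\<lambda>t. p - t) -` S)"
      using S by (intro open_vimage continuous_intros)
    then have 1: "{y \<in> \<Omega>. \<phi> y \<in> (\<lambda>t. p - t) -` S} \<in> events" by (rule pre)
    have "g -` S \<inter> space P = {y \<in> \<Omega>. \<phi> y \<in> (\<lambda>t. p - t) -` S} \<union> (if 0 \<in> S then space P - \<Omega> else {})"
      by (auto simp: g_def split: if_splits)
    also have "\<dots> \<in> events" using 1 sets.compl_sets[OF \<Omega>_sets] by (auto intro: sets.Un)
    finally show "g -` S \<inter> space P \<in> events" .
  qed
  have "compact_space seq_topology"
    unfolding seq_topology_def by (simp add: compact_space_product_topology compact_space_discrete_topology)
  then have "compactin seq_topology \<Omega>" using closed closedin_compact_space by blast
  then have "compactin (subtopology seq_topology \<Omega>) \<Omega>" by (simp add: compactin_subtopology)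
  then have "compact (\<phi> ` \<Omega>)"
    using image_compactin[OF _ cont] by simp
  then have "bounded (\<phi> ` \<Omega>)" by (rule compact_imp_bounded)
  then obtain b where b: "\<And>y. y \<in> \<Omega> \<Longrightarrow> \<bar>\<phi> y\<bar> \<le> b" by (auto simp: bounded_iff)
  have g_bd: "\<bar>g y\<bar> \<le> \<bar>p\<bar> + \<bar>b\<bar>" for y
    using b[of y] by (auto simp: g_def)
  have main: "\<exists>c. \<forall>y\<in>supp_seqs P. \<forall>j n.
       \<bar>ln (word_prob P (subword y j n)) + birkhoff_sum g n ((shift ^^ j) y)\<bar> \<le> \<eta> * real n + c"
    if \<eta>: "\<eta> > 0" for \<eta>
  proof -
    obtain c where c: "c \<ge> 0" "\<And>n. ln (K n) \<le> \<eta> * real n + c"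
      using smallo_linear_bound[OF K_o \<eta>] by blast
    have "\<bar>ln (word_prob P (subword y j n)) + birkhoff_sum g n ((shift ^^ j) y)\<bar> \<le> \<eta> * real n + c"
      if y: "y \<in> supp_seqs P" for y j n
    proof (cases "n = 0")
      case True
      then show ?thesis using c(1) by (simp add: birkhoff_sum_def)
    next
      case False
      then have n: "n \<ge> 1" by simp
      let ?z = "(shift ^^ j) y"
      let ?W = "word_prob P (subword y j n)"
      have z: "?z \<in> \<Omega>"
        using y supp_seqs_subset_closed[OF closed one] inv' by blast
      have W: "?W > 0" using y by (rule supp_seqs_subword_pos)
      have S: "birkhoff_sum \<phi> n ?z - real n * p = - birkhoff_sum g n ?z"
        using inv'[OF z] by (simp add: birkhoff_sum_def g_def sum_subtractf)
      have "ln (inverse (K n) * exp (- birkhoff_sum g n ?z)) \<le> ln ?W"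
        using gibbs[OF z n] K[OF n] W unfolding initial_word_shift p_def[symmetric] S
        by (intro ln_mono) auto
      then have 1: "- ln (K n) - birkhoff_sum g n ?z \<le> ln ?W"
        using K[OF n] by (simp add: ln_mult ln_inverse)
      have "ln ?W \<le> ln (K n * exp (- birkhoff_sum g n ?z))"
        using gibbs[OF z n] K[OF n] W unfolding initial_word_shift p_def[symmetric] S
        by (intro ln_mono) auto
      then have 2: "ln ?W \<le> ln (K n) - birkhoff_sum g n ?z"
        using K[OF n] by (simp add: ln_mult)
      show ?thesis using 1 2 c(2)[of n] by linarith
    qed
    then show ?thesis by blast
  qed
  show thesis by (rule that[OF g_meas g_bd main])
qed

end

section \<open>The cross entropy as an integral of the potential\<close>

context stationary_pair
begin

text \<open>Integrate the Gibbs estimate against \<open>Q\<close>: invariance gives the Birkhoff sum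
  the exact integral \<open>real n * ?h\<close>, and the error per letter is at most \<eta> + c/n
  with \<eta> arbitrary. Convergence is part of the result, so \<open>lim\<close> denotes a genuine
  limit.\<close>

lemma cross_entropy_eq_integral:
  assumes supp: "supp_seqs Q \<subseteq> supp_seqs P"
    and g_P: "g \<in> borel_measurable P" and bd: "\<And>y. \<bar>g y\<bar> \<le> B"
    and gibbs: "\<And>\<eta>. \<eta> > 0 \<Longrightarrow> \<exists>c. \<forall>y\<in>supp_seqs P. \<forall>j n.
       \<bar>ln (word_prob P (subword y j n)) + birkhoff_sum g n ((shift ^^ j) y)\<bar> \<le> \<eta> * real n + c"
  shows "cross_entropy Q P = ereal (\<integral>y. g y \<partial>Q)"
proof -
  let ?h = "\<integral>y. g y \<partial>Q"
  have g [measurable]: "g \<in> borel_measurable Q"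
    using g_P measurable_cong_sets[OF P.sets_P refl] measurable_cong_sets[OF Q.sets_P refl] by blast
  define E where "E n = (\<Sum>a | length a = n. word_prob Q a * ln (word_prob P a))" for n
  \<comment> \<open>If Q[a] = 0, both sides are 0 by convention. Otherwise a support point of
    \<open>Q\<close> starts with \<open>a\<close>, and the inclusion of supports makes P[a]
    positive, hence the term finite.\<close>
  have summand: "ereal (word_prob Q a) * eln (word_prob P a) = ereal (word_prob Q a * ln (word_prob P a))"
    for a
  proof (cases "word_prob Q a = 0")
    case True
    then show ?thesis by (simp add: zero_ereal_def[symmetric])
  next
    case False
    then have "word_prob Q a > 0" using Q.word_prob_nonneg[of a] by linarith
    then obtain y where y: "y \<in> supp_seqs Q" "initial_word y (length a) = a"
      using Q.word_prob_pos_supp_seqs by blast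
    then have "word_prob P a > 0"
      using P.supp_seqs_subword_pos[of y 0 "length a"] supp by (auto simp: subword_initial)
    then show ?thesis by (simp add: eln_def)
  qed
  have seq: "- (\<Sum>a | length a = n. ereal (word_prob Q a) * eln (word_prob P a)) / ereal (real n)
      = ereal (- E n / real n)" if "n \<ge> 1" for n
    unfolding summand E_def using that by simp
  have E_bound: "\<exists>c. \<forall>n. \<bar>E n + real n * ?h\<bar> \<le> \<eta> * real n + c" if \<eta>: "\<eta> > 0" for \<eta>
  proof -
    obtain c where c: "\<forall>y\<in>supp_seqs P. \<forall>j n.
       \<bar>ln (word_prob P (subword y j n)) + birkhoff_sum g n ((shift ^^ j) y)\<bar> \<le> \<eta> * real n + c"
      using gibbs[OF \<eta>] by blast
    have "\<bar>E n + real n * ?h\<bar> \<le> \<eta> * real n + c" for n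
    proof -
      have S_int: "integrable Q (\<lambda>y. g ((shift ^^ j) y))" for j
        by (rule Q.integrable_const_bound[where B = B]) (use bd in auto)
      then have S_int': "integrable Q (\<lambda>y. birkhoff_sum g n y)"
        unfolding birkhoff_sum_def by simp
      have S_eq: "(\<integral>y. birkhoff_sum g n y \<partial>Q) = real n * ?h"
        unfolding birkhoff_sum_def using S_int
        by (simp add: Q.integral_shift_funpow[OF g])
      let ?f = "\<lambda>y. ln (word_prob P (subword y 0 n)) + birkhoff_sum g n y"
      have f_le: "AE y in Q. \<bar>?f y\<bar> \<le> \<eta> * real n + c"
        using Q.AE_supp_seqs
      proof eventually_elim
        case (elim y)
        then have "y \<in> supp_seqs P" using supp by blast
        with c have "\<bar>ln (word_prob P (subword y 0 n)) + birkhoff_sum g n ((shift ^^ 0) y)\<bar> \<le> \<eta> * real n + c"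
          by blast
        then show ?case by simp
      qed
      have f_meas: "?f \<in> borel_measurable Q"
        unfolding birkhoff_sum_def by measurable
      have f_int: "integrable Q ?f"
        by (rule Q.integrable_const_bound[where B = "\<eta> * real n + c"]) (use f_le f_meas in auto)
      \<comment> \<open>The log-probability is controlled only together with the Birkhoff sum, so
        its integrability comes from a difference of integrable functions.\<close>
      have l_int: "integrable Q (\<lambda>y. ln (word_prob P (subword y 0 n)))"
        using Bochner_Integration.integrable_diff[OF f_int S_int'] by simp
      have "(\<integral>y. ?f y \<partial>Q) = E n + real n * ?h"
        using l_int S_int' Q.integral_subword[of "\<lambda>a. ln (word_prob P a)"] by (simp add: S_eq E_def)
      moreover have "\<bar>\<integral>y. ?f y \<partial>Q\<bar> \<le> (\<integral>y. \<bar>?f y\<bar> \<partial>Q)" by (rule integral_abs_bound)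
      moreover have "(\<integral>y. \<bar>?f y\<bar> \<partial>Q) \<le> (\<integral>y. \<eta> * real n + c \<partial>Q)"
        using f_int f_le by (intro integral_mono_AE) auto
      ultimately show ?thesis using Q.prob_space by simp
    qed
    then show ?thesis by blast
  qed
  have lim: "(\<lambda>n. - E n / real n) \<longlonglongrightarrow> ?h"
  proof (rule LIMSEQ_I)
    fix r :: real assume r: "r > 0"
    obtain c where c: "\<And>n. \<bar>E n + real n * ?h\<bar> \<le> r / 2 * real n + c"
      using E_bound[of "r / 2"] r by auto
    have "(\<lambda>n. c / real n) \<longlonglongrightarrow> 0" by (rule lim_const_over_n)
    then have "\<forall>\<^sub>F n in sequentially. c / real n < r / 2"
      using r by (intro order_tendstoD) auto
    then have "\<forall>\<^sub>F n in sequentially. norm (- E n / real n - ?h) < r"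
      using eventually_gt_at_top[of 0]
    proof eventually_elim
      case (elim n)
      have "- E n / real n - ?h = - (E n + real n * ?h) / real n"
        using elim(2) by (simp add: field_simps)
      then have "norm (- E n / real n - ?h) = \<bar>E n + real n * ?h\<bar> / real n"
        by (simp only: real_norm_def abs_divide abs_minus_cancel abs_of_nat)
      also have "\<dots> \<le> (r / 2 * real n + c) / real n" by (intro divide_right_mono c) simp
      also have "\<dots> = r / 2 + c / real n" using elim(2) by (simp add: field_simps)
      finally show ?case using elim(1) by linarith
    qed
    then show "\<exists>no. \<forall>n\<ge>no. norm (- E n / real n - ?h) < r" by (simp add: eventually_sequentially)
  qed
  have "(\<lambda>n. - (\<Sum>a | length a = n. ereal (word_prob Q a) * eln (word_prob P a)) / ereal (real n))
      \<longlonglongrightarrow> ereal ?h"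
    by (rule Lim_transform_eventually[OF tendsto_ereal[OF lim]])
      (use seq in \<open>auto simp: eventually_sequentially intro!: exI[of _ 1]\<close>)
  then show ?thesis unfolding cross_entropy_def by (rule limI)
qed

end

section \<open>Parsing\<close>

lemma mzm_next_length_le: "mzm_next_length xs ys \<le> length ys"
proof (cases "\<exists>k\<le>length ys. \<not> sublist (take k ys) xs")
  case True
  then obtain k where "k \<le> length ys" "\<not> sublist (take k ys) xs" by blast
  moreover from this(2) have "(LEAST k. \<not> sublist (take k ys) xs) \<le> k" by (rule Least_le)
  ultimately show ?thesis using True by (simp add: mzm_next_length_def)
next
  case False
  then show ?thesis unfolding mzm_next_length_def by (simp only: if_False order_refl)
qed

text \<open>Minimality of the cut, or, for a last word without a cut, the fact that all its prefixes
  occur. So every parsed word, the last one included, is a match plus one letter.\<close>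

lemma sublist_take_pred_mzm_next_length:
  assumes "ys \<noteq> []"
  shows "sublist (take (mzm_next_length xs ys - 1) ys) xs"
proof (cases "\<exists>k\<le>length ys. \<not> sublist (take k ys) xs")
  case True
  then have "mzm_next_length xs ys = (LEAST k. \<not> sublist (take k ys) xs)"
    by (simp add: mzm_next_length_def)
  moreover have "mzm_next_length xs ys - 1 < mzm_next_length xs ys"
    using mzm_next_length_pos[OF assms] by simp
  ultimately show ?thesis using not_less_Least by metis
next
  case False
  then show ?thesis by (metis diff_le_self le_trans mzm_next_length_le)
qed

text \<open>The strict inequality sets aside the final word, which may well occur in
  \<open>xs\<close>.\<close>

lemma not_sublist_take_mzm_next_length:
  assumes "mzm_next_length xs ys < length ys"
  shows "\<not> sublist (take (mzm_next_length xs ys) ys) xs"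
proof -
  have ex: "\<exists>k\<le>length ys. \<not> sublist (take k ys) xs"
    using assms unfolding mzm_next_length_def by (auto split: if_splits)
  then have "mzm_next_length xs ys = (LEAST k. \<not> sublist (take k ys) xs)"
    by (simp add: mzm_next_length_def)
  then show ?thesis using LeastI_ex[of "\<lambda>k. \<not> sublist (take k ys) xs"] ex by auto
qed

lemma drop_subword: "drop m (subword y j n) = subword y (j + m) (n - m)"
  by (cases "m \<le> n") (simp_all add: subword_def drop_map)

lemma subword_eq_Nil_iff [simp]: "subword y j n = [] \<longleftrightarrow> n = 0"
  by (auto simp: subword_def)

section \<open>Additive functionals along the parsing\<close>

lemma sum_lessThan_split_offset:
  fixes G :: "nat \<Rightarrow> real"
  assumes "m \<le> n"
  shows "(\<Sum>i<n. G (j + i)) = (\<Sum>i<m. G (j + i)) + (\<Sum>i<n - m. G (j + m + i))"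
proof -
  have "(\<Sum>i<m + k. G (j + i)) = (\<Sum>i<m. G (j + i)) + (\<Sum>i<k. G (j + (m + i)))" for k
    by (induction k) auto
  from this[of "n - m"] show ?thesis using assms by (simp add: add.assoc)
qed

text \<open>Distinct words have distinct starts, so each exceptional start in \<open>D\<close> is
  charged \<open>V\<close> at most once. The induction runs over suffixes with the right end N held
  fixed.\<close>

lemma mzm_parse_sum_le:
  fixes G :: "nat \<Rightarrow> real"
  assumes step: "\<And>j d. d > 0 \<Longrightarrow> j + d = N \<Longrightarrow>
      (\<Sum>i<mzm_next_length xs (subword y j d). G (j + i)) \<le> U + (if j \<in> D then V else 0)"
    and V: "V \<ge> 0" and "j + d = N"
  shows "(\<Sum>i<d. G (j + i))
    \<le> U * real (length (mzm_parse xs (subword y j d))) + V * real (card (D \<inter> {j..<N}))"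
  using \<open>j + d = N\<close>
proof (induction d arbitrary: j rule: less_induct)
  case (less d)
  show ?case
  proof (cases "d = 0")
    case True
    then show ?thesis using V by (simp add: mzm_parse.simps)
  next
    case False
    define l where "l = mzm_next_length xs (subword y j d)"
    have l: "l > 0" "l \<le> d"
      using False mzm_next_length_pos[of "subword y j d" xs] mzm_next_length_le[of xs "subword y j d"]
      by (auto simp: l_def)
    have len: "length (mzm_parse xs (subword y j d))
        = Suc (length (mzm_parse xs (subword y (j + l) (d - l))))"
      using False by (subst mzm_parse.simps) (simp add: l_def drop_subword)
    have IH: "(\<Sum>i<d - l. G (j + l + i)) \<le> U * real (length (mzm_parse xs (subword y (j + l) (d - l))))
        + V * real (card (D \<inter> {j + l..<N}))"
      using less.IH[of "d - l" "j + l"] l less.prems by simp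
    have st: "(\<Sum>i<l. G (j + i)) \<le> U + (if j \<in> D then V else 0)"
      unfolding l_def using False less.prems by (intro step) auto
    have card: "(if j \<in> D then V else 0) + V * real (card (D \<inter> {j + l..<N})) \<le> V * real (card (D \<inter> {j..<N}))"
    proof (cases "j \<in> D")
      case True
      have "insert j (D \<inter> {j + l..<N}) \<subseteq> D \<inter> {j..<N}"
        using True l less.prems by auto
      then have "card (insert j (D \<inter> {j + l..<N})) \<le> card (D \<inter> {j..<N})"
        by (rule card_mono[rotated]) simp
      then have "1 + real (card (D \<inter> {j + l..<N})) \<le> real (card (D \<inter> {j..<N}))"
        using l by simp
      then have "V * (1 + real (card (D \<inter> {j + l..<N}))) \<le> V * real (card (D \<inter> {j..<N}))"
        using V by (rule mult_left_mono)
      then show ?thesis using True by (simp add: distrib_left)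
    next
      case False
      have "card (D \<inter> {j + l..<N}) \<le> card (D \<inter> {j..<N})" by (rule card_mono) auto
      then show ?thesis using False V by (simp add: mult_left_mono)
    qed
    have "(\<Sum>i<d. G (j + i)) = (\<Sum>i<l. G (j + i)) + (\<Sum>i<d - l. G (j + l + i))"
      by (rule sum_lessThan_split_offset[OF l(2)])
    also have "\<dots> \<le> U * (1 + real (length (mzm_parse xs (subword y (j + l) (d - l)))))
        + V * real (card (D \<inter> {j..<N}))"
      using st IH card by (simp add: distrib_left)
    finally show ?thesis by (simp add: len)
  qed
qed

text \<open>The last word may be cut off by the end of \<open>y\<close> and so guarantees only
  \<open>- V\<close>; this accounts for the count less one.\<close>

lemma mzm_parse_sum_ge:
  fixes G :: "nat \<Rightarrow> real"
  assumes step: "\<And>j d. d > 0 \<Longrightarrow> j + d = N \<Longrightarrow> mzm_next_length xs (subword y j d) < d \<Longrightarrow>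
      U \<le> (\<Sum>i<mzm_next_length xs (subword y j d). G (j + i))"
    and last: "\<And>j d. d > 0 \<Longrightarrow> j + d = N \<Longrightarrow> mzm_next_length xs (subword y j d) = d \<Longrightarrow>
      - V \<le> (\<Sum>i<d. G (j + i))"
    and "d > 0" "j + d = N"
  shows "U * (real (length (mzm_parse xs (subword y j d))) - 1) - V \<le> (\<Sum>i<d. G (j + i))"
  using \<open>d > 0\<close> \<open>j + d = N\<close>
proof (induction d arbitrary: j rule: less_induct)
  case (less d)
  define l where "l = mzm_next_length xs (subword y j d)"
  have l: "l > 0" "l \<le> d"
    using less.prems mzm_next_length_pos[of "subword y j d" xs] mzm_next_length_le[of xs "subword y j d"]
    by (auto simp: l_def)
  have len: "length (mzm_parse xs (subword y j d))
      = Suc (length (mzm_parse xs (subword y (j + l) (d - l))))"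
    using less.prems by (subst mzm_parse.simps) (simp add: l_def drop_subword)
  show ?case
  proof (cases "l = d")
    case True
    then have "mzm_parse xs (subword y (j + l) (d - l)) = []" by (simp add: mzm_parse.simps)
    then have "length (mzm_parse xs (subword y j d)) = 1" by (simp only: len list.size)
    then show ?thesis using last[OF less.prems] True by (simp add: l_def)
  next
    case False
    then have IH: "U * (real (length (mzm_parse xs (subword y (j + l) (d - l)))) - 1) - V
        \<le> (\<Sum>i<d - l. G (j + l + i))"
      using less.IH[of "d - l" "j + l"] l less.prems by simp
    have "U \<le> (\<Sum>i<l. G (j + i))"
      using step[OF less.prems] False l by (simp add: l_def)
    then have "U + (U * (real (length (mzm_parse xs (subword y (j + l) (d - l)))) - 1) - V)
        \<le> (\<Sum>i<l. G (j + i)) + (\<Sum>i<d - l. G (j + l + i))"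
      using IH by (rule add_mono)
    also have "\<dots> = (\<Sum>i<d. G (j + i))"
      by (rule sum_lessThan_split_offset[OF l(2), symmetric])
    finally show ?thesis by (simp add: len algebra_simps)
  qed
qed

text \<open>The deterministic end of the argument: divide both bounds by N and let \<epsilon> tend
  to 0 along a sequence. The shift by 7 keeps \<epsilon> below 1/6 and thus
  \<open>1 - 3 * \<epsilon>\<close> above 1/2; the third \<epsilon> absorbs the constant
  \<open>c'\<close> into \<open>ln (real N)\<close>.\<close>

lemma count_asymptotics_of_bounds:
  fixes S c :: "nat \<Rightarrow> real"
  assumes S: "(\<lambda>N. S N / real N) \<longlonglongrightarrow> h"
    and c1: "\<And>N. N \<ge> 1 \<Longrightarrow> c N \<ge> 1" and B: "B > 0" and C: "C > 0"
    and bounds: "\<And>m \<epsilon>. \<epsilon> = 1 / (real m + 7) \<Longrightarrow> \<exists>c'. \<forall>\<^sub>F N in sequentially.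
      ((1 - 2 * \<epsilon>) * ln (real N) - c') * (c N - 1) - B * (C * ln (real N) + 1) \<le> S N \<and>
      S N \<le> ((1 + 2 * \<epsilon>) * ln (real N) + c') * c N + B * (C * ln (real N) + 1) * real N powr (1 - \<epsilon> / 2)"
  shows "(\<lambda>N. c N * ln (real N) / real N) \<longlonglongrightarrow> h"
proof -
  define u where "u N = c N * ln (real N) / real N" for N
  have key: "\<forall>\<^sub>F N in sequentially. u N \<ge> 0 \<and> (1 - 3 * \<epsilon>) * u N \<le> h + \<epsilon> \<and> h - \<epsilon> \<le> (1 + 3 * \<epsilon>) * u N"
    if m: "\<epsilon> = 1 / (real m + 7)" for \<epsilon> m
  proof -
    have \<epsilon>: "0 < \<epsilon>" "\<epsilon> < 1/6" by (auto simp: m field_simps)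
    obtain c' where c': "\<forall>\<^sub>F N in sequentially.
      ((1 - 2 * \<epsilon>) * ln (real N) - c') * (c N - 1) - B * (C * ln (real N) + 1) \<le> S N \<and>
      S N \<le> ((1 + 2 * \<epsilon>) * ln (real N) + c') * c N + B * (C * ln (real N) + 1) * real N powr (1 - \<epsilon> / 2)"
      using bounds[OF m] by blast
    have e1: "\<forall>\<^sub>F N in sequentially. \<bar>S N / real N - h\<bar> < \<epsilon> / 2"
      using tendstoD[OF S, of "\<epsilon> / 2"] \<epsilon> by (simp add: dist_real_def)
    have e2: "\<forall>\<^sub>F N in sequentially. c' \<le> \<epsilon> * ln (real N)"
      using \<epsilon> by real_asymp
    have e3: "\<forall>\<^sub>F N in sequentially. (ln (real N) + B * (C * ln (real N) + 1)) / real N < \<epsilon> / 2"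
      using \<epsilon> B C by real_asymp
    have e4: "\<forall>\<^sub>F N in sequentially. B * (C * ln (real N) + 1) * real N powr (1 - \<epsilon> / 2) / real N < \<epsilon> / 2"
      using \<epsilon> B C by real_asymp
    show ?thesis
      using c' e1 e2 e3 e4 eventually_ge_at_top[of 1]
    proof eventually_elim
      case (elim N)
      define L where "L = ln (real N)"
      have N: "real N > 0" using elim(6) by simp
      have L: "L \<ge> 0" using elim(6) by (simp add: L_def)
      have c: "c N \<ge> 1" using c1 elim(6) by blast
      have u0: "u N \<ge> 0" using c L by (simp add: u_def L_def)
      have "(1 - 3 * \<epsilon>) * L * (c N - 1) \<le> ((1 - 2 * \<epsilon>) * L - c') * (c N - 1)"
        using elim(3) c by (intro mult_right_mono) (auto simp: L_def algebra_simps)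
      also have "\<dots> \<le> S N + B * (C * L + 1)" using elim(1) by (simp add: L_def)
      finally have "(1 - 3 * \<epsilon>) * (c N * L) \<le> S N + ((1 - 3 * \<epsilon>) * L + B * (C * L + 1))"
        by (simp add: algebra_simps)
      also have "\<dots> \<le> S N + (L + B * (C * L + 1))"
        using L \<epsilon> by (simp add: algebra_simps)
      finally have "(1 - 3 * \<epsilon>) * (c N * L) / real N \<le> (S N + (L + B * (C * L + 1))) / real N"
        using N by (intro divide_right_mono) auto
      then have "(1 - 3 * \<epsilon>) * u N \<le> S N / real N + (L + B * (C * L + 1)) / real N"
        by (simp add: u_def L_def add_divide_distrib)
      then have 1: "(1 - 3 * \<epsilon>) * u N \<le> h + \<epsilon>"
        using elim(2,4) unfolding L_def abs_less_iff by linarith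
      have "((1 + 2 * \<epsilon>) * L + c') * c N \<le> ((1 + 3 * \<epsilon>) * L) * c N"
        using elim(3) c by (intro mult_right_mono) (auto simp: L_def algebra_simps)
      with elim(1) have "S N \<le> (1 + 3 * \<epsilon>) * (c N * L) + B * (C * L + 1) * real N powr (1 - \<epsilon> / 2)"
        by (simp add: L_def algebra_simps)
      then have "S N / real N \<le> ((1 + 3 * \<epsilon>) * (c N * L) + B * (C * L + 1) * real N powr (1 - \<epsilon> / 2)) / real N"
        using N by (intro divide_right_mono) auto
      then have "S N / real N \<le> (1 + 3 * \<epsilon>) * u N + B * (C * L + 1) * real N powr (1 - \<epsilon> / 2) / real N"
        by (simp add: u_def L_def add_divide_distrib)
      then have 2: "h - \<epsilon> \<le> (1 + 3 * \<epsilon>) * u N"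
        using elim(2,5) unfolding L_def abs_less_iff by linarith
      show ?case using u0 1 2 by blast
    qed
  qed
  \<comment> \<open>A crude a priori bound from \<epsilon> = 1/8. It turns the relative error
    \<open>3 * \<epsilon> * u N\<close> into an additive one.\<close>
  have bdd: "\<forall>\<^sub>F N in sequentially. u N \<le> 4 * (\<bar>h\<bar> + 1)"
    using key[of "1/8" 1] by (auto elim!: eventually_mono)
  have "u \<longlonglongrightarrow> h"
  proof (rule tendstoI)
    fix r :: real assume r: "r > 0"
    \<comment> \<open>The total error is \<epsilon> + 3 \<epsilon> u, and \<open>bdd\<close> bounds
      3 u by 12 (|h| + 1).\<close>
    define R where "R = 1 + 12 * (\<bar>h\<bar> + 1)"
    have R: "R > 0" by (simp add: R_def add_pos_nonneg)
    obtain m where m: "1 / real (Suc m) < r / R"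
      using nat_approx_posE[of "r / R"] r R by auto
    define \<epsilon> where "\<epsilon> = 1 / (real m + 7)"
    have "\<epsilon> \<le> 1 / real (Suc m)" by (simp add: \<epsilon>_def frac_le)
    then have "\<epsilon> < r / R" using m by linarith
    then have \<epsilon>: "0 < \<epsilon>" "\<epsilon> * R < r"
      using R by (auto simp: \<epsilon>_def field_simps)
    show "\<forall>\<^sub>F N in sequentially. dist (u N) h < r"
      using key[OF \<epsilon>_def] bdd
    proof eventually_elim
      case (elim N)
      have "\<epsilon> * (3 * u N) \<le> \<epsilon> * (12 * (\<bar>h\<bar> + 1))"
        using elim \<epsilon> by (intro mult_left_mono) auto
      then have "\<bar>u N - h\<bar> \<le> \<epsilon> * R"
        using elim by (simp add: R_def abs_le_iff algebra_simps)
      then show ?case using \<epsilon>(2) by (simp add: dist_real_def)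
    qed
  qed
  then show ?thesis by (simp add: u_def[abs_def])
qed

lemma mzm_count_pos: "N \<ge> 1 \<Longrightarrow> mzm_count N y x \<ge> 1"
  unfolding mzm_count_def by (subst mzm_parse.simps) (simp add: initial_word_def)

text \<open>Convergence of c_N ln N / N forces c_N / N to 0, so the denominator N - c_N is
  asymptotic to N and the infinite value is eventually never taken.\<close>

lemma mzm_estimator_tendsto:
  assumes "(\<lambda>N. real (mzm_count N y x) * ln (real N) / real N) \<longlonglongrightarrow> h"
  shows "(\<lambda>N. mzm_estimator N y x) \<longlonglongrightarrow> ereal h"
proof -
  define c where "c N = real (mzm_count N y x)" for N
  have u: "(\<lambda>N. c N * ln (real N) / real N) \<longlonglongrightarrow> h" using assms by (simp add: c_def)
  have "(\<lambda>N. inverse (ln (real N))) \<longlonglongrightarrow> 0" by real_asymp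
  with u have "(\<lambda>N. c N * ln (real N) / real N * inverse (ln (real N))) \<longlonglongrightarrow> h * 0"
    by (rule tendsto_mult)
  moreover have "\<forall>\<^sub>F N in sequentially. c N * ln (real N) / real N * inverse (ln (real N)) = c N / real N"
    using eventually_gt_at_top[of 1] by eventually_elim (auto simp: field_simps)
  ultimately have "(\<lambda>N. c N / real N) \<longlonglongrightarrow> h * 0"
    by (rule Lim_transform_eventually)
  then have d: "(\<lambda>N. c N / real N) \<longlonglongrightarrow> 0" by simp
  have "(\<lambda>N. (c N * ln (real N) / real N) / (1 - c N / real N)) \<longlonglongrightarrow> h / (1 - 0)"
    by (intro tendsto_intros u d) simp
  then have lim: "(\<lambda>N. (c N * ln (real N) / real N) / (1 - c N / real N)) \<longlonglongrightarrow> h" by simp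
  have "\<forall>\<^sub>F N in sequentially. c N / real N < 1"
    using d by (intro order_tendstoD) auto
  then have "\<forall>\<^sub>F N in sequentially.
      ereal ((c N * ln (real N) / real N) / (1 - c N / real N)) = mzm_estimator N y x"
    using eventually_gt_at_top[of 0]
  proof eventually_elim
    case (elim N)
    then have "c N < real N" by simp
    then have "mzm_count N y x \<noteq> N" by (simp add: c_def)
    then have "mzm_estimator N y x = ereal (c N * ln (real N) / (real N - c N))"
      by (simp add: mzm_estimator_def c_def)
    moreover have "(c N * ln (real N) / real N) / (1 - c N / real N) = c N * ln (real N) / (real N - c N)"
      using elim by (simp add: field_simps)
    ultimately show ?case by simp
  qed
  then show ?thesis by (rule Lim_transform_eventually[OF tendsto_ereal[OF lim]])
qed

section \<open>From a fixed pair of sequences to almost sure convergence\<close>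

context stationary_pair
begin

text \<open>All randomness sits in \<open>matches\<close>, \<open>likely\<close> and
  \<open>unlikely\<close>; the rest is deterministic. The lower bound uses the full parsed word,
  which is new to \<open>x\<close>, and the upper bound the word without its last letter, which is a
  match. Each 2 \<epsilon> is one \<epsilon> from the probability threshold and one from the Gibbs
  error.\<close>

lemma mzm_count_bounds:
  fixes g :: "(nat \<Rightarrow> 'a) \<Rightarrow> real"
  assumes y: "y \<in> supp_seqs P" and bd: "\<And>z. \<bar>g z\<bar> \<le> B" and B: "B > 0" and C: "C > 0"
    and \<epsilon>: "0 < \<epsilon>"
    and gibbs: "\<And>\<eta>. \<eta> > 0 \<Longrightarrow> \<exists>c. \<forall>y\<in>supp_seqs P. \<forall>j n.
       \<bar>ln (word_prob P (subword y j n)) + birkhoff_sum g n ((shift ^^ j) y)\<bar> \<le> \<eta> * real n + c"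
    and matches: "\<forall>\<^sub>F N in sequentially. \<forall>j\<le>N. \<forall>n.
       sublist (subword y j n) (initial_word x N) \<longrightarrow> real n \<le> C * ln (real N)"
    and likely: "\<forall>\<^sub>F N in sequentially. \<forall>a. length a \<ge> 1 \<and> real (length a) \<le> C * ln (real N) + 1
       \<and> word_prob P a \<ge> real N powr (\<epsilon> - 1) \<longrightarrow> sublist a (initial_word x N)"
    and unlikely: "\<forall>\<^sub>F N in sequentially.
       real (card (unlikely_matches (real N powr (- 1 - \<epsilon>)) N N x y)) \<le> real N powr (1 - \<epsilon> / 2)"
  shows "\<exists>c'. \<forall>\<^sub>F N in sequentially.
      ((1 - 2 * \<epsilon>) * ln (real N) - c') * (real (mzm_count N y x) - 1) - B * (C * ln (real N) + 1)
        \<le> birkhoff_sum g N y \<and>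
      birkhoff_sum g N y \<le> ((1 + 2 * \<epsilon>) * ln (real N) + c') * real (mzm_count N y x)
        + B * (C * ln (real N) + 1) * real N powr (1 - \<epsilon> / 2)"
proof -
  \<comment> \<open>Makes the Gibbs error of a word of length at most
    \<open>C * ln (real N) + 1\<close> equal to \<epsilon> ln N plus a constant.\<close>
  define \<eta> where "\<eta> = \<epsilon> / C"
  have \<eta>: "\<eta> > 0" using \<epsilon> C by (simp add: \<eta>_def)
  obtain c where c: "\<forall>y\<in>supp_seqs P. \<forall>j n.
      \<bar>ln (word_prob P (subword y j n)) + birkhoff_sum g n ((shift ^^ j) y)\<bar> \<le> \<eta> * real n + c"
    using gibbs[OF \<eta>] by blast
  define G where "G i = g ((shift ^^ i) y)" for i
  \<comment> \<open>\<open>B\<close> pays for the last letter of a word, which the match does not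
    cover.\<close>
  define c' where "c' = \<bar>\<eta> + c\<bar> + B"
  have S: "birkhoff_sum g n ((shift ^^ j) y) = (\<Sum>i<n. G (j + i))" for n j
    by (simp add: birkhoff_sum_def G_def shift_funpow add.assoc)
  have "\<forall>\<^sub>F N in sequentially.
      ((1 - 2 * \<epsilon>) * ln (real N) - c') * (real (mzm_count N y x) - 1) - B * (C * ln (real N) + 1)
        \<le> birkhoff_sum g N y \<and>
      birkhoff_sum g N y \<le> ((1 + 2 * \<epsilon>) * ln (real N) + c') * real (mzm_count N y x)
        + B * (C * ln (real N) + 1) * real N powr (1 - \<epsilon> / 2)"
    using matches likely unlikely eventually_ge_at_top[of 1]
  proof eventually_elim
    case (elim N)
    define L where "L = ln (real N)"
    define xs where "xs = initial_word x N"
    define D where "D = unlikely_matches (real N powr (- 1 - \<epsilon>)) N N x y"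
    define V where "V = B * (C * L + 1)"
    define U where "U = (1 + 2 * \<epsilon>) * L + c'"
    have N: "real N > 0" using elim(4) by simp
    have L: "L \<ge> 0" using elim(4) by (simp add: L_def)
    have V: "V \<ge> 0" using B C L by (simp add: V_def)
    have U: "U \<ge> 0" using B \<epsilon> L by (simp add: U_def c'_def)
    have est: "\<bar>ln (word_prob P (subword y j n)) + (\<Sum>i<n. G (j + i))\<bar> \<le> \<epsilon> * L + \<bar>\<eta> + c\<bar>"
      if n: "real n \<le> C * L + 1" for j n
    proof -
      have "\<bar>ln (word_prob P (subword y j n)) + (\<Sum>i<n. G (j + i))\<bar> \<le> \<eta> * real n + c"
        using c y unfolding S[symmetric] by blast
      moreover have "\<eta> * real n \<le> \<eta> * (C * L + 1)" using n \<eta> by (intro mult_left_mono) auto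
      moreover have "\<eta> * (C * L + 1) = \<epsilon> * L + \<eta>" using C by (simp add: \<eta>_def field_simps)
      ultimately show ?thesis by linarith
    qed
    \<comment> \<open>Facts true of every parsed word, final or exceptional ones included;
      \<open>V\<close> is the trivial bound, length times supremum of \<open>g\<close>.\<close>
    have word: "sublist (subword y j (l - 1)) xs \<and> real (l - 1) \<le> C * L \<and> real l \<le> C * L + 1
        \<and> l > 0 \<and> \<bar>\<Sum>i<l. G (j + i)\<bar> \<le> V"
      if "d > 0" "j + d = N" and l: "l = mzm_next_length xs (subword y j d)" for j d l
    proof -
      have ne: "subword y j d \<noteq> []" using that by simp
      have l_pos: "l > 0" unfolding l using ne by (rule mzm_next_length_pos)
      have l_le: "l \<le> d" unfolding l using mzm_next_length_le[of xs "subword y j d"] by simp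
      have sub: "sublist (subword y j (l - 1)) xs"
        using sublist_take_pred_mzm_next_length[OF ne, of xs] l_le
        by (simp add: l[symmetric] take_subword)
      then have len: "real (l - 1) \<le> C * L"
        using elim(1)[rule_format, of j "l - 1"] that(2) by (simp add: xs_def L_def)
      then have len': "real l \<le> C * L + 1" using l_pos by (simp add: of_nat_diff)
      have "\<bar>\<Sum>i<l. G (j + i)\<bar> \<le> (\<Sum>i<l. \<bar>G (j + i)\<bar>)" by (rule sum_abs)
      also have "\<dots> \<le> (\<Sum>i<l. B)" unfolding G_def by (intro sum_mono bd)
      also have "\<dots> \<le> V" using len' B by (simp add: V_def mult.commute)
      finally show ?thesis using sub len len' l_pos by blast
    qed
    have count: "mzm_count N y x = length (mzm_parse xs (subword y 0 N))"
      by (simp add: mzm_count_def xs_def subword_initial)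
    have S0: "birkhoff_sum g N y = (\<Sum>i<N. G (0 + i))" using S[of N 0] by simp
    have lower: "((1 - 2 * \<epsilon>) * L - c') * (real (mzm_count N y x) - 1) - V \<le> birkhoff_sum g N y"
      unfolding count S0
    proof (rule mzm_parse_sum_ge[where N = N])
      fix j d assume d: "d > 0" "j + d = N" "mzm_next_length xs (subword y j d) < d"
      define l where "l = mzm_next_length xs (subword y j d)"
      note l = word[OF d(1,2) l_def]
      have new: "\<not> sublist (subword y j l) xs"
        using not_sublist_take_mzm_next_length[of xs "subword y j d"] d(3)
        by (simp add: l_def take_subword)
      have "\<not> real N powr (\<epsilon> - 1) \<le> word_prob P (subword y j l)"
        using elim(2)[rule_format, of "subword y j l"] l new by (auto simp: xs_def L_def)
      then have "word_prob P (subword y j l) < real N powr (\<epsilon> - 1)" by simp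
      then have "ln (word_prob P (subword y j l)) < ln (real N powr (\<epsilon> - 1))"
        using P.supp_seqs_subword_pos[OF y] N by (subst ln_less_cancel_iff) auto
      also have "\<dots> = (\<epsilon> - 1) * L" using N by (simp add: ln_powr L_def)
      finally have "(1 - \<epsilon>) * L - (\<epsilon> * L + \<bar>\<eta> + c\<bar>) \<le> (\<Sum>i<l. G (j + i))"
        using est[of l j] l by (simp add: algebra_simps abs_le_iff)
      then show "(1 - 2 * \<epsilon>) * L - c' \<le> (\<Sum>i<mzm_next_length xs (subword y j d). G (j + i))"
        using B by (simp add: l_def[symmetric] c'_def algebra_simps)
    next
      fix j d assume d: "d > 0" "j + d = N" "mzm_next_length xs (subword y j d) = d"
      show "- V \<le> (\<Sum>i<d. G (j + i))"
        using word[OF d(1,2) d(3)[symmetric]] by (simp add: abs_le_iff)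
    qed (use elim(4) in auto)
    have "birkhoff_sum g N y \<le> U * real (mzm_count N y x) + V * real (card (D \<inter> {0..<N}))"
      unfolding count S0
    proof (rule mzm_parse_sum_le[where N = N])
      fix j d assume d: "d > 0" "j + d = N"
      define l where "l = mzm_next_length xs (subword y j d)"
      note l = word[OF d l_def]
      show "(\<Sum>i<mzm_next_length xs (subword y j d). G (j + i)) \<le> U + (if j \<in> D then V else 0)"
      proof (cases "j \<in> D")
        case True
        then show ?thesis using l U by (simp add: l_def[symmetric] abs_le_iff)
      next
        case False
        then have "\<not> word_prob P (subword y j (l - 1)) \<le> real N powr (- 1 - \<epsilon>)"
          using l d by (auto simp: D_def unlikely_matches_def xs_def)
        then have "real N powr (- 1 - \<epsilon>) < word_prob P (subword y j (l - 1))" by simp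
        then have "ln (real N powr (- 1 - \<epsilon>)) < ln (word_prob P (subword y j (l - 1)))"
          using P.supp_seqs_subword_pos[OF y] N by (subst ln_less_cancel_iff) auto
        then have "(- 1 - \<epsilon>) * L < ln (word_prob P (subword y j (l - 1)))"
          using N by (simp add: ln_powr L_def)
        moreover have "(\<Sum>i<l - 1. G (j + i))
            \<le> \<epsilon> * L + \<bar>\<eta> + c\<bar> - ln (word_prob P (subword y j (l - 1)))"
          using est[of "l - 1" j] l by linarith
        ultimately have "(\<Sum>i<l - 1. G (j + i)) \<le> (1 + 2 * \<epsilon>) * L + \<bar>\<eta> + c\<bar>"
          by (simp add: algebra_simps)
        moreover have "(\<Sum>i<l. G (j + i)) = (\<Sum>i<l - 1. G (j + i)) + G (j + (l - 1))"
          using l by (cases l) auto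
        moreover have "G (j + (l - 1)) \<le> B"
          using bd[of "(shift ^^ (j + (l - 1))) y"] by (simp add: G_def abs_le_iff)
        ultimately show ?thesis using False by (simp add: l_def[symmetric] U_def c'_def)
      qed
    qed (use V elim(4) in auto)
    also have "D \<inter> {0..<N} = D" by (auto simp: D_def unlikely_matches_def)
    also have "V * real (card D) \<le> V * real N powr (1 - \<epsilon> / 2)"
      unfolding D_def by (intro mult_left_mono elim(3) V)
    finally show ?case using lower by (simp add: U_def V_def L_def)
  qed
  then show ?thesis by blast
qed

theorem AE_mzm_estimator_tendsto:
  assumes sld: "selectively_lower_decoupled P" and nd: "nondegenerate_pair P Q"
    and supp: "supp_seqs Q \<subseteq> supp_seqs P" and wg: "weak_Gibbs P" and erg: "ergodic Q"
  shows "AE (x, y) in P \<Otimes>\<^sub>M Q. (\<lambda>N. mzm_estimator N y x) \<longlonglongrightarrow> cross_entropy Q P"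
proof -
  obtain g B0 where g: "g \<in> borel_measurable P" and B0: "\<And>y. \<bar>g y\<bar> \<le> B0"
    and gibbs: "\<And>\<eta>. \<eta> > 0 \<Longrightarrow> \<exists>c. \<forall>y\<in>supp_seqs P. \<forall>j n.
       \<bar>ln (word_prob P (subword y j n)) + birkhoff_sum g n ((shift ^^ j) y)\<bar> \<le> \<eta> * real n + c"
    using P.weak_Gibbs_potential[OF wg] by blast
  have gQ: "g \<in> borel_measurable Q"
    using g measurable_cong_sets[OF P.sets_P refl] measurable_cong_sets[OF Q.sets_P refl] by blast
  \<comment> \<open>Adding 1 ensures the strict positivity that the asymptotic estimates
    require.\<close>
  define B where "B = B0 + 1"
  have "B0 \<ge> 0" using B0[of undefined] by linarith
  then have B: "B > 0" by (simp add: B_def)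
  have B_bd: "\<bar>g y\<bar> \<le> B" for y using B0[of y] by (simp add: B_def)
  let ?h = "\<integral>y. g y \<partial>Q"
  have ce: "cross_entropy Q P = ereal ?h"
    by (rule cross_entropy_eq_integral[OF supp g B0 gibbs])
  obtain C where C: "C > 0" and match: "AE p in P \<Otimes>\<^sub>M Q. \<forall>\<^sub>F N in sequentially. \<forall>j\<le>N. \<forall>n.
    sublist (subword (snd p) j n) (initial_word (fst p) N) \<longrightarrow> real n \<le> C * ln (real N)"
    using AE_match_length[OF nd] by blast
  \<comment> \<open>A countable family of margins, so that the almost sure statements hold
    simultaneously for all of them.\<close>
  define e where "e m = 1 / (real m + 7)" for m
  have e: "0 < e m" "e m \<le> 1" for m by (auto simp: e_def)
  have "AE x in P. \<forall>m. \<forall>\<^sub>F N in sequentially. \<forall>a. length a \<ge> 1 \<and> real (length a) \<le> C * ln (real N) + 1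
      \<and> word_prob P a \<ge> real N powr (e m - 1) \<longrightarrow> sublist a (initial_word x N)"
    unfolding AE_all_countable by (intro allI P.AE_likely_words_occur sld e C)
  note likely = AE_fst[OF this]
  have unlikely: "AE p in P \<Otimes>\<^sub>M Q. \<forall>m. \<forall>\<^sub>F N in sequentially.
      real (card (unlikely_matches (real N powr (- 1 - e m)) N N (fst p) (snd p))) \<le> real N powr (1 - e m / 2)"
    unfolding AE_all_countable by (intro allI AE_few_unlikely_matches e)
  note birk = AE_snd[OF Q.birkhoff[OF erg gQ B0]]
  note suppQ = AE_snd[OF Q.AE_supp_seqs]
  from match likely unlikely birk suppQ
  have "AE p in P \<Otimes>\<^sub>M Q. (\<lambda>N. mzm_estimator N (snd p) (fst p)) \<longlonglongrightarrow> cross_entropy Q P"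
  proof eventually_elim
    case (elim p)
    have "(\<lambda>N. real (mzm_count N (snd p) (fst p)) * ln (real N) / real N) \<longlonglongrightarrow> ?h"
    proof (rule count_asymptotics_of_bounds[OF elim(4) _ B C])
      fix N :: nat assume "N \<ge> 1"
      then show "real (mzm_count N (snd p) (fst p)) \<ge> 1"
        using mzm_count_pos[of N "snd p" "fst p"] by simp
    next
      fix m :: nat and \<epsilon> :: real assume "\<epsilon> = 1 / (real m + 7)"
      then have \<epsilon>: "\<epsilon> = e m" by (simp add: e_def)
      show "\<exists>c'. \<forall>\<^sub>F N in sequentially.
        ((1 - 2 * \<epsilon>) * ln (real N) - c') * (real (mzm_count N (snd p) (fst p)) - 1) - B * (C * ln (real N) + 1)
          \<le> birkhoff_sum g N (snd p) \<and>
        birkhoff_sum g N (snd p) \<le> ((1 + 2 * \<epsilon>) * ln (real N) + c') * real (mzm_count N (snd p) (fst p))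
          + B * (C * ln (real N) + 1) * real N powr (1 - \<epsilon> / 2)"
        unfolding \<epsilon>
      proof (rule mzm_count_bounds[OF _ B_bd B C e(1) gibbs elim(1) elim(2)[rule_format] elim(3)[rule_format]])
        show "snd p \<in> supp_seqs P" using elim(5) supp by blast
      qed
    qed
    then show ?case unfolding ce by (rule mzm_estimator_tendsto)
  qed
  then show ?thesis by (simp add: case_prod_unfold)
qed

end

theorem corollary5p5:
  fixes P Q :: "(nat \<Rightarrow> 'a::finite) measure"
  assumes "shift_invariant_prob P"
    and "shift_invariant_prob Q"
    and "selectively_lower_decoupled P"
    and "upper_decoupled P"
    and "upper_decoupled Q"
    and "nondegenerate_pair P Q"
    and "supp_seqs Q \<subseteq> supp_seqs P"
    and "weak_Gibbs P"
    and "ergodic Q"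
  shows "AE (x, y) in P \<Otimes>\<^sub>M Q. (\<lambda>N. mzm_estimator N y x) \<longlonglongrightarrow> cross_entropy Q P"
proof -
  interpret stationary_pair P Q
    using assms(1,2) by (simp add: stationary_pair_def stationary_def)
  show ?thesis using assms by (intro AE_mzm_estimator_tendsto)
qed

end
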